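(* Let $S\subseteq\mathbb N$ be a numerical semigroup with left part $L$ such that $|L|\le 12$. Then $W_0(S)\ge 0$. In particular, $W(S)=e|L|-c\ge 0$, i.e. $S$ satisfies Wilf's conjecture.
   Context: A numerical semigroup is a submonoid $S$ of $(\mathbb N,+)$ with $\mathbb N\setminus S$ finite. Let $S^*=S\setminus\{0\}$; $m=\min S^*$ is the multiplicity; the conductor $c$ is the least $c\in\mathbb N$ with $[c,\infty[\subseteq S$; the left part is $L=S\cap[0,c-1]$; $P$ is the minimal generating set of $S$ (the primitive elements, i.e. elements of $S^*$ that are not a sum of two elements of $S^*$), $e=|P|$ is the embedding dimension, and $D=S^*\setminus P=S^*+S^*$. The depth is $q=\lceil c/m\rceil$ and the offset is $\rho=qm-c\in[0,m-1]$. For $j\in\mathbb Z$ let $I_j=[jm-\rho,(j+1)m-\rho-1]$ (integer interval) and $D_j=D\cap I_j$; note $I_q=[c,c+m-1]$. Define $W(S)=e|L|-c$ and $W_0(S)=|P\cap L|\,|L|-q|D_q|+\rho$. *)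

theory Defs
  imports Complex_Main
begin

definition numerical_semigroup :: "nat set \<Rightarrow> bool" where
  "numerical_semigroup S \<longleftrightarrow>
     0 \<in> S \<and> (\<forall>x\<in>S. \<forall>y\<in>S. x + y \<in> S) \<and> finite (UNIV - S)"

definition nonzero_part :: "nat set \<Rightarrow> nat set" where
  "nonzero_part S = S - {0}"

definition multiplicity :: "nat set \<Rightarrow> nat" where
  "multiplicity S = (LEAST x. x \<in> nonzero_part S)"

definition conductor :: "nat set \<Rightarrow> nat" where
  "conductor S = (LEAST c. {c..} \<subseteq> S)"

text \<open>Written as \<open>{..<c}\<close> because \<open>{0..c - 1}\<close> would be \<open>{0}\<close>, not empty, when \<open>c = 0\<close>
  (that is, when \<open>S = UNIV\<close>).\<close>
definition left_part :: "nat set \<Rightarrow> nat set" where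
  "left_part S = S \<inter> {..<conductor S}"

definition primitives :: "nat set \<Rightarrow> nat set" where
  "primitives S =
     {x \<in> nonzero_part S. \<not> (\<exists>a\<in>nonzero_part S. \<exists>b\<in>nonzero_part S. x = a + b)}"

definition embedding_dimension :: "nat set \<Rightarrow> nat" where
  "embedding_dimension S = card (primitives S)"

definition decomposables :: "nat set \<Rightarrow> nat set" where
  "decomposables S = nonzero_part S - primitives S"

lemma decomposables_eq_sums:
  assumes "numerical_semigroup S"
  shows "decomposables S = {a + b |a b. a \<in> nonzero_part S \<and> b \<in> nonzero_part S}"
  using assms
  by (auto simp: decomposables_def primitives_def nonzero_part_def numerical_semigroup_def)

definition depth :: "nat set \<Rightarrow> int" where
  "depth S = \<lceil>real (conductor S) / real (multiplicity S)\<rceil>"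

definition offset :: "nat set \<Rightarrow> int" where
  "offset S = depth S * int (multiplicity S) - int (conductor S)"

definition slice :: "nat set \<Rightarrow> int \<Rightarrow> int set" where
  "slice S j = {j * int (multiplicity S) - offset S ..
                (j + 1) * int (multiplicity S) - offset S - 1}"

definition decomposables_slice :: "nat set \<Rightarrow> int \<Rightarrow> nat set" where
  "decomposables_slice S j = {x \<in> decomposables S. int x \<in> slice S j}"

definition Wilf_number :: "nat set \<Rightarrow> int" where
  "Wilf_number S =
     int (embedding_dimension S) * int (card (left_part S)) - int (conductor S)"

definition Wilf_number0 :: "nat set \<Rightarrow> int" where
  "Wilf_number0 S =
     int (card (primitives S \<inter> left_part S)) * int (card (left_part S))
       - depth S * int (card (decomposables_slice S (depth S))) + offset S"

end

theory Submission
  imports Defs "HOL-Library.Multiset_Order"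
begin

text \<open>
  Let \<open>A\<close> be the set of nonzero Apery elements below \<open>c\<close>, \<open>G\<close> the left primitives other than \<open>m\<close>,
  \<open>Z\<close> the decomposable Apery elements below \<open>c + m\<close>, and for \<open>a \<in> A\<close> let \<open>w a\<close> be the number of
  elements of \<open>a + m\<nat>\<close> below \<open>c\<close>. Then \<open>|L| = q + (\<Sum>a\<in>A. w a)\<close>, and \<open>W\<^sub>0 \<ge> 0\<close> becomes
  \<open>q |Z| \<le> (|G| + 1) (\<Sum>a\<in>A. w a) + \<rho>\<close>. If \<open>z = a + b \<in> Z\<close>, then \<open>a, b \<in> A\<close> and \<open>w a + w b \<ge> q\<close>,
  up to a loss of 1 that occurs only for the \<open>\<rho>\<close> largest values of \<open>z\<close>. Writing each \<open>z\<close> as its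
  least monomial in \<open>G\<close>, the monomials of degree 2 are paid for exactly by the weights of \<open>G\<close>, since a
  complete graph with loops on \<open>G\<close> has all degrees \<open>|G| + 1\<close>.

  Only the monomials of degree at least 3 need more. If they are all powers of one generator \<open>x\<close>, pair
  \<open>k x\<close> with \<open>(s - k) x\<close>. If \<open>q = 3\<close>, a fractional count of the divisors of degree 2 suffices.
  Otherwise \<open>q \<ge> 4\<close> and two generators \<open>x\<close>, \<open>y\<close> are involved; then the weights of
  \<open>x\<close>, \<open>y\<close> and two of the quadratic monomials sum to at least \<open>2 q - 2\<close>, so \<open>3 q - 2 \<le> |L| \<le> 12\<close>
  forces \<open>q = 4\<close> and total weight at most 8, and few configurations remain.
\<close>

section \<open>Multisets as monomials in the generators\<close>

lemma sum_mset_image_eq_sum_count: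
  fixes h :: "'a \<Rightarrow> nat"
  assumes "finite G" "set_mset N \<subseteq> G"
  shows "(\<Sum>g\<in>#N. h g) = (\<Sum>g\<in>G. count N g * h g)"
  using assms(2)
proof (induction N)
  case (add x N)
  have "(\<Sum>g\<in>G. count (add_mset x N) g * h g)
      = (\<Sum>g\<in>G. count N g * h g + (if g = x then h g else 0))"
    by (intro sum.cong) auto
  also have "\<dots> = (\<Sum>g\<in>G. count N g * h g) + h x"
    using add.prems assms(1) by (simp add: sum.distrib)
  finally show ?case using add by simp
qed simp

text \<open>Summing over \<open>g \<in># N\<close> with multiplicity is what makes the bound uniform: every \<open>M\<close> of size \<open>k\<close>
  is hit with total multiplicity at most \<open>\<Sum>g\<in>G. count M g + 1 = |G| + k\<close>.\<close>
lemma shadow_sum_le: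
  fixes W :: "'a multiset \<Rightarrow> nat"
  assumes G: "finite G" and D: "finite \<D>"
    and N: "\<And>N. N \<in> \<N> \<Longrightarrow> set_mset N \<subseteq> G"
    and shadow: "\<And>N g. N \<in> \<N> \<Longrightarrow> g \<in># N \<Longrightarrow> N - {#g#} \<in> \<D>"
    and size: "\<And>M. M \<in> \<D> \<Longrightarrow> set_mset M \<subseteq> G \<and> size M = k"
    and fin: "finite \<N>"
  shows "(\<Sum>N\<in>\<N>. \<Sum>g\<in>#N. W (N - {#g#})) \<le> (card G + k) * (\<Sum>M\<in>\<D>. W M)"
proof -
  let ?P = "Sigma \<N> set_mset"
  let ?h = "\<lambda>(N, g). (N - {#g#}, g)"
  have inj: "inj_on ?h ?P"
    by (intro inj_on_inverseI[of _ "\<lambda>(M, g). (add_mset g M, g)"]) auto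
  have "(\<Sum>N\<in>\<N>. \<Sum>g\<in>#N. W (N - {#g#}))
      = (\<Sum>N\<in>\<N>. \<Sum>g\<in>set_mset N. count N g * W (N - {#g#}))"
    by (intro sum.cong refl sum_mset_image_eq_sum_count) auto
  also have "\<dots> = (\<Sum>(N, g)\<in>?P. count N g * W (N - {#g#}))"
    using fin by (simp add: sum.Sigma)
  \<comment> \<open>As \<open>g\<close> occurs in \<open>N\<close>, its count drops by exactly one
    in \<open>N - {#g#}\<close>; the summand now depends only on the image pair under
    \<open>?h\<close>.\<close>
  also have "\<dots> = (\<Sum>(N, g)\<in>?P. Suc (count (N - {#g#}) g) * W (N - {#g#}))"
    by (intro sum.cong refl) (auto simp del: mult_Suc)
  also have "\<dots> = (\<Sum>(M, g)\<in>?h ` ?P. Suc (count M g) * W M)"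
    by (subst sum.reindex[OF inj]) (simp add: case_prod_beta o_def)
  also have "\<dots> \<le> (\<Sum>(M, g)\<in>\<D> \<times> G. Suc (count M g) * W M)"
  proof (rule sum_mono2)
    show "?h ` ?P \<subseteq> \<D> \<times> G" using N shadow by fastforce
  qed (use G D in auto)
  also have "\<dots> = (\<Sum>M\<in>\<D>. \<Sum>g\<in>G. Suc (count M g) * W M)"
    by (simp add: sum.cartesian_product)
  also have "\<dots> = (\<Sum>M\<in>\<D>. (card G + k) * W M)"
  proof (intro sum.cong refl)
    fix M assume "M \<in> \<D>"
    then have M: "set_mset M \<subseteq> G" "size M = k" using size by auto
    have "(\<Sum>g\<in>G. count M g) = k"
      using sum_mset_image_eq_sum_count[OF G M(1), of "\<lambda>_. 1"] M(2) by simp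
    then show "(\<Sum>g\<in>G. Suc (count M g) * W M) = (card G + k) * W M"
      by (simp add: sum.distrib add_mult_distrib flip: sum_distrib_right)
  qed
  also have "\<dots> = (card G + k) * (\<Sum>M\<in>\<D>. W M)"
    by (simp add: sum_distrib_left)
  finally show ?thesis .
qed

lemma doubleton_mset_eq_iff:
  "{#a, b#} = {#c, d#} \<longleftrightarrow> a = c \<and> b = d \<or> a = d \<and> b = c"
  by (auto simp: add_eq_conv_ex)

lemma size_2E:
  assumes "size M = 2" obtains x y where "M = {#x, y#}"
proof -
  have "size M = Suc 1" using assms by simp
  then obtain x N where N: "M = add_mset x N" by (blast dest: size_eq_Suc_imp_eq_union)
  then have "size N = 1" using assms by simp
  then obtain y where "N = {#y#}" using size_1_singleton_mset by blast
  then show thesis using that N by simp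
qed

lemma size_3E:
  assumes "size M = 3" obtains x y z where "M = {#x, y, z#}"
proof -
  have "size M = Suc 2" using assms by simp
  then obtain x N where N: "M = add_mset x N" by (blast dest: size_eq_Suc_imp_eq_union)
  then have "size N = 2" using assms by simp
  then obtain y z where "N = {#y, z#}" by (rule size_2E)
  then show thesis using that N by simp
qed

lemma two_elements_cubic:
  assumes "set_mset M \<subseteq> {x, y}" "size M = 3"
  shows "M \<in> {{#x, x, x#}, {#x, x, y#}, {#x, y, y#}, {#y, y, y#}}"
proof -
  obtain a b d where M: "M = {#a, b, d#}" using assms(2) by (rule size_3E)
  then have "a = x \<or> a = y" "b = x \<or> b = y" "d = x \<or> d = y" using assms(1) by auto
  then show ?thesis unfolding M by (auto simp: add_mset_commute)
qed

section \<open>Apery elements and their monomials\<close>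

locale left_semigroup =
  fixes S :: "nat set" and m c q \<rho> :: nat
  assumes zero: "0 \<in> S" and add: "x \<in> S \<Longrightarrow> y \<in> S \<Longrightarrow> x + y \<in> S"
    and m_in: "m \<in> S" and m_pos: "0 < m" and m_le: "x \<in> S \<Longrightarrow> 0 < x \<Longrightarrow> m \<le> x"
    and c_eq: "c + \<rho> = q * m" and rho_less: "\<rho> < m"
    and m_less: "m < c"
begin

text \<open>This says that \<open>x - m\<close> is not in \<open>S\<close>, written additively
  because truncated subtraction gives \<open>0 - m = 0\<close> and would exclude
  \<open>0\<close>.\<close>

definition apery :: "nat \<Rightarrow> bool" where
  "apery x \<longleftrightarrow> x \<in> S \<and> (\<forall>s\<in>S. x \<noteq> s + m)"

definition dec :: "nat \<Rightarrow> bool" where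
  "dec x \<longleftrightarrow> (\<exists>a\<in>S. \<exists>b\<in>S. 0 < a \<and> 0 < b \<and> x = a + b)"

definition G :: "nat set" where "G = {x \<in> S. 0 < x \<and> x < c \<and> x \<noteq> m \<and> \<not> dec x}"
definition A :: "nat set" where "A = {x. apery x \<and> 0 < x \<and> x < c}"
definition Z :: "nat set" where "Z = {x. apery x \<and> dec x \<and> x < c + m}"

text \<open>For \<open>x < c\<close> this is the number of elements of \<open>x + m\<nat>\<close> below \<open>c\<close>; equivalently
  \<open>x\<close> lies in the interval \<open>I\<^sub>j\<close> with \<open>j = q - w x\<close>.\<close>
definition w :: "nat \<Rightarrow> nat" where "w x = q - (x + \<rho>) div m"

text \<open>Marks the last \<open>\<rho>\<close> elements of \<open>I\<^sub>q\<close>, the only ones at which \<open>a \<in> I\<^sub>i\<close>, \<open>b \<in> I\<^sub>j\<close>,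
  \<open>a + b \<in> I\<^sub>q\<close> can occur with \<open>i + j = q + 1\<close>.\<close>
definition \<delta> :: "nat \<Rightarrow> nat" where "\<delta> z = (if c + m - \<rho> \<le> z then 1 else 0)"

text \<open>Minimality in the multiset order, which is compatible with addition, makes every
  sub-multiset of a \<open>rep\<close> again a \<open>rep\<close>.\<close>
definition rep :: "nat \<Rightarrow> nat multiset" where
  "rep x = (LEAST M. set_mset M \<subseteq> G \<and> sum_mset M = x)"

text \<open>Adding \<open>\<rho>\<close> moves the threshold \<open>c\<close> to the multiple
  \<open>q * m\<close>, so division by \<open>m\<close> compares exactly. For
  \<open>x \<ge> c\<close> truncation gives \<open>w x = 0\<close>.\<close>

lemma less_w_iff: "j < w x \<longleftrightarrow> x + j * m < c"
proof -
  have "j < w x \<longleftrightarrow> (x + \<rho>) div m + j < q" unfolding w_def by linarith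
  also have "\<dots> \<longleftrightarrow> (x + \<rho> + j * m) div m < q" using m_pos by (simp add: add.commute)
  also have "\<dots> \<longleftrightarrow> x + \<rho> + j * m < q * m" using m_pos by (rule div_less_iff_less_mult)
  also have "\<dots> \<longleftrightarrow> x + j * m < c" using c_eq by linarith
  finally show ?thesis .
qed

lemma c_le_w: "c \<le> x + w x * m"
  using less_w_iff[of "w x" x] by linarith

lemma apery_summand: "apery (a + b) \<Longrightarrow> a \<in> S \<Longrightarrow> b \<in> S \<Longrightarrow> apery a"
  unfolding apery_def by (metis add ab_semigroup_add_class.add_ac(1) add.commute)

lemma apery_cong:
  assumes "apery x" "apery y" "x mod m = y mod m" shows "x = y"
proof -
  have le: "y \<le> x" if xy: "apery x" "apery y" "x mod m = y mod m" for x y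
  proof (rule ccontr)
    assume "\<not> y \<le> x"
    then have less: "x < y" by simp
    then have "m dvd y - x" using xy(3) by (metis mod_eq_dvd_iff_nat less_imp_le_nat)
    then obtain k where k: "y = x + m * k" using less by (metis dvdE le_add_diff_inverse less_imp_le_nat)
    then obtain k' where k': "k = Suc k'" using less by (cases k) auto
    have "k'' * m \<in> S" for k'' by (induction k'') (auto simp: zero add m_in)
    then have "x + k' * m \<in> S" using xy(1) by (auto simp: apery_def add)
    moreover have "y = (x + k' * m) + m" using k k' by (simp add: algebra_simps)
    ultimately show False using xy(2) by (auto simp: apery_def)
  qed
  show ?thesis using le[OF assms] le[of y x] assms by auto
qed

lemma finite_G: "finite G" and finite_A: "finite A" and finite_Z: "finite Z"
proof -
  show "finite G" unfolding G_def by (rule finite_subset[of _ "{..<c}"]) auto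
  show "finite A" unfolding A_def by (rule finite_subset[of _ "{..<c}"]) auto
  show "finite Z" unfolding Z_def by (rule finite_subset[of _ "{..<c + m}"]) auto
qed

lemma A_eq: "A = G \<union> {z \<in> Z. z < c}" and G_Z_disjoint: "G \<inter> Z = {}"
proof -
  have GA: "x \<in> A" if "x \<in> G" for x
  proof -
    have "x \<noteq> s + m" if "s \<in> S" for s
      using \<open>x \<in> G\<close> that m_in m_pos by (cases "s = 0") (auto simp: G_def dec_def)
    then show ?thesis using that by (auto simp: G_def A_def apery_def)
  qed
  have "z \<in> A" if "z \<in> Z" "z < c" for z using that by (auto simp: A_def Z_def dec_def)
  moreover have "x \<in> G \<or> x \<in> Z" if "x \<in> A" for x
  proof (cases "dec x")
    case True
    then show ?thesis using that by (simp add: A_def Z_def)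
  next
    case False
    have "x \<noteq> m" using that zero unfolding A_def apery_def by force
    then show ?thesis using that False by (simp add: A_def G_def apery_def)
  qed
  moreover have "x < c" if "x \<in> A" for x using that by (simp add: A_def)
  ultimately show "A = G \<union> {z \<in> Z. z < c}" using GA by blast
  show "G \<inter> Z = {}" by (auto simp: G_def Z_def)
qed

text \<open>The other summand is at least \<open>m\<close>, which brings \<open>a\<close> from below
  \<open>c + m\<close> to below \<open>c\<close>.\<close>

lemma summand_in_A:
  assumes "apery (a + b)" "a + b < c + m" "a \<in> S" "b \<in> S" "0 < a" "0 < b"
  shows "a \<in> A"
  using apery_summand[OF assms(1,3,4)] m_le[OF assms(4,6)] assms by (auto simp: A_def)

text \<open>Split repeatedly; the summands always lie in \<open>A\<close>. The last hypothesis
  excludes primitives in \<open>[c, c + m)\<close>, which are not in \<open>G\<close>.\<close>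

lemma exists_rep:
  assumes "apery x" "x < c + m" "x < c \<or> dec x"
  shows "\<exists>M. set_mset M \<subseteq> G \<and> sum_mset M = x"
  using assms
proof (induction x rule: less_induct)
  case (less x)
  consider "x = 0" | "0 < x" "\<not> dec x" | "dec x" by blast
  then show ?case
  proof cases
    case 1
    then show ?thesis by (intro exI[of _ "{#}"]) simp
  next
    case 2
    then have "x \<in> A" using less.prems by (auto simp: A_def)
    then have "x \<in> G" using 2 unfolding A_eq by (auto simp: Z_def)
    then show ?thesis by (intro exI[of _ "{#x#}"]) simp
  next
    case 3
    then obtain a b where ab: "a \<in> S" "b \<in> S" "0 < a" "0 < b" "x = a + b" by (auto simp: dec_def)
    have "a \<in> A" "b \<in> A"
      using summand_in_A[of a b] summand_in_A[of b a] ab less.prems by (auto simp: add.commute)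
    then obtain M N where "set_mset M \<subseteq> G" "sum_mset M = a" "set_mset N \<subseteq> G" "sum_mset N = b"
      using less.IH[of a] less.IH[of b] ab by (auto simp: A_def)
    then show ?thesis using ab by (intro exI[of _ "M + N"]) simp
  qed
qed

lemma rep:
  assumes "x \<in> A \<union> Z" shows "set_mset (rep x) \<subseteq> G" "sum_mset (rep x) = x"
proof -
  have "\<exists>M. set_mset M \<subseteq> G \<and> sum_mset M = x"
    using assms by (intro exists_rep) (auto simp: A_def Z_def)
  then have "set_mset (rep x) \<subseteq> G \<and> sum_mset (rep x) = x"
    unfolding rep_def by (rule LeastI_ex)
  then show "set_mset (rep x) \<subseteq> G" "sum_mset (rep x) = x" by auto
qed

text \<open>Exchange argument: replacing the factor \<open>N\<close> of \<open>rep x\<close> by the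
  least representation of its sum again represents \<open>x\<close>, so it cannot make the multiset
  smaller.\<close>

lemma rep_subset:
  assumes "x \<in> A \<union> Z" "N \<subseteq># rep x" shows "rep (sum_mset N) = N"
proof -
  have N: "set_mset N \<subseteq> G" using rep(1)[OF assms(1)] set_mset_mono[OF assms(2)] by blast
  let ?M = "rep (sum_mset N)"
  have M: "set_mset ?M \<subseteq> G \<and> sum_mset ?M = sum_mset N"
    unfolding rep_def by (rule LeastI[of _ N]) (use N in auto)
  have le: "?M \<le> N" unfolding rep_def by (rule Least_le) (use N in auto)
  obtain K where K: "rep x = N + K" using assms(2) by (metis subset_mset.add_diff_inverse)
  have "rep x \<le> ?M + K"
    unfolding rep_def[of x]
  proof (rule Least_le)
    show "set_mset (?M + K) \<subseteq> G \<and> sum_mset (?M + K) = x"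
      using M K rep[OF assms(1)] by auto
  qed
  then have "N \<le> ?M" unfolding K by simp
  with le show ?thesis by simp
qed

lemma G_in_S: "x \<in> G \<Longrightarrow> x \<in> S" "x \<in> G \<Longrightarrow> 0 < x" by (auto simp: G_def)

lemma sum_mset_G: "set_mset M \<subseteq> G \<Longrightarrow> sum_mset M \<in> S \<and> (M \<noteq> {#} \<longrightarrow> 0 < sum_mset M)"
  by (induction M) (auto simp: zero add G_in_S)

lemma rep_nonempty: "x \<in> A \<union> Z \<Longrightarrow> rep x \<noteq> {#}"
  using rep[of x] by (auto simp: A_def Z_def dec_def)

lemma rep_G: assumes "x \<in> G" shows "rep x = {#x#}"
proof -
  have x: "x \<in> A \<union> Z" using assms A_eq by auto
  then obtain y M where M: "rep x = add_mset y M" using rep_nonempty by (meson multiset_cases)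
  have "M = {#}"
  proof (rule ccontr)
    assume "M \<noteq> {#}"
    then have "dec x" unfolding dec_def
      using rep[OF x] M sum_mset_G[of M] G_in_S[of y]
      by (intro bexI[of _ y] bexI[of _ "sum_mset M"]) auto
    then show False using assms by (auto simp: G_def)
  qed
  then have "rep x = {#y#}" using M by simp
  moreover from this have "y = x" using rep(2)[OF x] by simp
  ultimately show ?thesis by (simp only:)
qed

lemma size_rep_Z: assumes "z \<in> Z" shows "2 \<le> size (rep z)"
proof (rule ccontr)
  assume less: "\<not> 2 \<le> size (rep z)"
  have z: "z \<in> A \<union> Z" using assms by simp
  obtain x M where M: "rep z = add_mset x M" using rep_nonempty[OF z] by (meson multiset_cases)
  have "size M = 0" using less unfolding M size_add_mset by linarith
  then have "M = {#}" by simp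
  then have y: "rep z = {#x#}" using M by simp
  then have "x = z" using rep(2)[OF z] by simp
  then have "z \<in> G" using rep(1)[OF z] y by simp
  then show False using assms G_Z_disjoint by blast
qed

text \<open>Each summand reaches \<open>c\<close> after \<open>w\<close> steps of \<open>m\<close>,
  so \<open>2 * c \<le> z + (w a + w b) * m\<close>. With \<open>z < c + m\<close> and
  \<open>c > (q - 1) * m\<close> at most one is lost, and nothing for \<open>z\<close> below
  \<open>c + m - \<rho>\<close>.\<close>

lemma w_split:
  assumes "z \<in> Z" "z = a + b" "a \<in> S" "b \<in> S" "0 < a" "0 < b"
  shows "q \<le> w a + w b + \<delta> z"
proof -
  have "2 * c \<le> z + (w a + w b) * m"
    using c_le_w[of a] c_le_w[of b] unfolding assms(2) distrib_right by linarith
  moreover have "z < c + m" using assms(1) by (auto simp: Z_def)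
  ultimately have 1: "c < (w a + w b + 1) * m" by (simp add: algebra_simps)
  have "q * m < (w a + w b + 2) * m" using 1 c_eq rho_less by (simp add: algebra_simps)
  then have "q < w a + w b + 2" by (rule mult_less_cancel2[THEN iffD1, THEN conjunct2])
  then have 2: "q \<le> w a + w b + 1" by simp
  show ?thesis
  proof (cases "c + m - \<rho> \<le> z")
    case True then show ?thesis using 2 by (simp add: \<delta>_def)
  next
    case False
    then have "z + \<rho> < c + m" using rho_less by linarith
    then have "q * m < (w a + w b + 1) * m"
      using \<open>2 * c \<le> _\<close> c_eq by (simp add: algebra_simps)
    then have "q < w a + w b + 1" by (rule mult_less_cancel2[THEN iffD1, THEN conjunct2])
    then show ?thesis by simp
  qed
qed

lemma rep_part:
  assumes "z \<in> Z" "rep z = M + N" "M \<noteq> {#}" "N \<noteq> {#}"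
  shows "sum_mset M \<in> A" "rep (sum_mset M) = M" "q \<le> w (sum_mset M) + w (sum_mset N) + \<delta> z"
    "sum_mset M + m \<le> z" "2 \<le> size M \<Longrightarrow> sum_mset M \<in> Z"
proof -
  have z: "z \<in> A \<union> Z" using assms by auto
  have G: "set_mset M \<subseteq> G" "set_mset N \<subseteq> G" "z = sum_mset M + sum_mset N"
    using rep[OF z] assms(2) by auto
  have S: "sum_mset M \<in> S" "sum_mset N \<in> S" "0 < sum_mset M" "0 < sum_mset N"
    using sum_mset_G[OF G(1)] sum_mset_G[OF G(2)] assms by auto
  show A: "sum_mset M \<in> A"
    using summand_in_A[of "sum_mset M" "sum_mset N"] assms(1) S unfolding G(3) Z_def by blast
  show R: "rep (sum_mset M) = M" by (rule rep_subset[OF z]) (simp add: assms(2))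
  show "q \<le> w (sum_mset M) + w (sum_mset N) + \<delta> z"
    by (rule w_split) (use assms(1) G S in auto)
  show "sum_mset M + m \<le> z" using G(3) m_le[of "sum_mset N"] S by simp
  assume size: "2 \<le> size M"
  have "sum_mset M \<notin> G"
  proof
    assume "sum_mset M \<in> G"
    then have "M = {#sum_mset M#}" using rep_G R by metis
    then have "size M = size {#sum_mset M#}" by (rule arg_cong)
    then show False using size by simp
  qed
  then show "sum_mset M \<in> Z" using A unfolding A_eq by auto
qed

lemma w_pos: "x \<in> A \<Longrightarrow> 0 < w x"
  by (simp add: less_w_iff A_def)

lemma w_mono: assumes "a + m \<le> z" "z < c" shows "w z < w a"
proof -
  obtain j where j: "w z = Suc j" using assms less_w_iff[of 0 z] by (cases "w z") auto
  then have "z + j * m < c" using less_w_iff[of j z] by simp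
  then have "a + w z * m < c" using assms(1) unfolding j mult_Suc by linarith
  then show ?thesis unfolding less_w_iff .
qed

lemma sum_delta_le: "(\<Sum>z\<in>Z. \<delta> z) \<le> \<rho>"
proof -
  have "(\<Sum>z\<in>Z. \<delta> z) = card {z \<in> Z. c + m - \<rho> \<le> z}"
    unfolding \<delta>_def using finite_Z by (simp add: sum.If_cases Int_def)
  also have "\<dots> \<le> card {c + m - \<rho>..<c + m}" by (intro card_mono) (auto simp: Z_def)
  also have "\<dots> = \<rho>" using rho_less by simp
  finally show ?thesis .
qed

text \<open>Distinct Apery elements have distinct residues modulo \<open>m\<close>; the extra one
  counts \<open>0\<close>.\<close>

lemma card_le_m: "Suc (card G + card Z) \<le> m"
proof -
  have "card (insert 0 (G \<union> Z)) \<le> card {..<m}"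
  proof (rule card_inj_on_le[of "\<lambda>x. x mod m"])
    have ap: "apery x" if "x \<in> insert 0 (G \<union> Z)" for x
    proof -
      have "apery 0" using zero m_pos by (simp add: apery_def)
      moreover have "x \<in> A \<Longrightarrow> apery x" "x \<in> Z \<Longrightarrow> apery x" by (simp_all add: A_def Z_def)
      ultimately show ?thesis using that A_eq by blast
    qed
    show "inj_on (\<lambda>x. x mod m) (insert 0 (G \<union> Z))"
      using apery_cong[OF ap ap] by (rule inj_onI)
  qed (use m_pos in auto)
  moreover have "card (insert 0 (G \<union> Z)) = Suc (card G + card Z)"
    using finite_G finite_Z G_Z_disjoint
    by (subst card_insert_disjoint) (auto simp: card_Un_disjoint G_def Z_def dec_def)
  ultimately show ?thesis by simp
qed

text \<open>Distinctness is tested on monomials, where comparing generators decides it, and not on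
  sums such as \<open>x + y\<close>, whose coincidences are not visible.\<close>

lemma distinct_sum_w_le:
  assumes "distinct (map rep xs)" "set xs \<subseteq> A"
  shows "sum_list (map w xs) \<le> (\<Sum>x\<in>A. w x)"
proof -
  have "distinct xs" using assms(1) by (simp add: distinct_map)
  then have "sum_list (map w xs) = (\<Sum>x\<in>set xs. w x)" by (simp add: sum_list_distinct_conv_sum_set)
  also have "\<dots> \<le> (\<Sum>x\<in>A. w x)" using assms(2) finite_A by (intro sum_mono2) auto
  finally show ?thesis .
qed

section \<open>Weights of quadratic monomials\<close>

definition Z2 :: "nat set" where "Z2 = {z \<in> Z. size (rep z) = 2}"
definition Z3 :: "nat set" where "Z3 = {z \<in> Z. 3 \<le> size (rep z)}"

definition pair_weight :: "nat \<Rightarrow> nat" where "pair_weight z = (\<Sum>x\<in>#rep z. w x)"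

lemma Z_split: "Z = Z2 \<union> Z3" "Z2 \<inter> Z3 = {}" "finite Z2" "finite Z3"
proof -
  show "Z = Z2 \<union> Z3" using size_rep_Z by (fastforce simp: Z2_def Z3_def)
  show "Z2 \<inter> Z3 = {}" by (auto simp: Z2_def Z3_def)
  show "finite Z2" "finite Z3" using finite_Z by (auto simp: Z2_def Z3_def)
qed

lemma Z2_E:
  assumes "z \<in> Z2"
  obtains x y where "rep z = {#x, y#}" "z = x + y" "x \<in> G" "y \<in> G" "pair_weight z = w x + w y"
    "q \<le> pair_weight z + \<delta> z"
proof -
  have z: "z \<in> Z" "size (rep z) = 2" using assms by (auto simp: Z2_def)
  obtain x y where r: "rep z = {#x, y#}" using z(2) by (rule size_2E)
  have "z = x + y" "x \<in> G" "y \<in> G" using rep[of z] z(1) r by auto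
  moreover have "pair_weight z = w x + w y" by (simp add: pair_weight_def r)
  moreover have "q \<le> w x + w y + \<delta> z" using rep_part(3)[of z "{#x#}" "{#y#}"] z(1) r by simp
  ultimately show thesis using that r by simp
qed

text \<open>The shadow bound with \<open>k = 1\<close>: removing one generator from a quadratic
  monomial leaves the other, so the inner sum is the pair weight.\<close>

lemma sum_pair_weight_le: "(\<Sum>z\<in>Z2. pair_weight z) \<le> (card G + 1) * (\<Sum>x\<in>G. w x)"
proof -
  let ?D = "(\<lambda>x. {#x#}) ` G"
  let ?W = "\<lambda>M. w (sum_mset M)"
  have inj: "inj_on rep Z2" by (intro inj_on_inverseI[of _ sum_mset]) (auto simp: Z2_def rep)
  have "(\<Sum>z\<in>Z2. pair_weight z) = (\<Sum>z\<in>Z2. \<Sum>g\<in>#rep z. ?W (rep z - {#g#}))"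
    by (intro sum.cong refl) (auto elim!: Z2_E)
  also have "\<dots> = (\<Sum>N\<in>rep ` Z2. \<Sum>g\<in>#N. ?W (N - {#g#}))"
    by (simp add: sum.reindex[OF inj])
  also have "\<dots> \<le> (card G + 1) * (\<Sum>M\<in>?D. ?W M)"
    by (rule shadow_sum_le) (auto simp: finite_G Z_split elim!: Z2_E)
  also have "(\<Sum>M\<in>?D. ?W M) = (\<Sum>x\<in>G. w x)"
    by (subst sum.reindex) (auto simp: inj_on_def)
  finally show ?thesis .
qed

section \<open>The reduced inequality\<close>

definition core :: bool where
  "core \<longleftrightarrow> q * card Z \<le> (card G + 1) * (\<Sum>x\<in>A. w x) + \<rho>"

lemma sum_A: "(\<Sum>x\<in>A. w x) = (\<Sum>x\<in>G. w x) + (\<Sum>x\<in>{z \<in> Z. z < c}. w x)"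
  unfolding A_eq using finite_G finite_Z G_Z_disjoint by (intro sum.union_disjoint) auto

text \<open>Quadratic monomials outside \<open>Q\<close> pay for themselves up to
  \<open>\<delta>\<close>. Those in \<open>Q\<close> pool their pair weights with
  \<open>card G + 1\<close> copies of the weights of \<open>D\<close> to pay for \<open>Q\<close>
  and \<open>Z3\<close>; \<open>r\<close> is the share of \<open>\<rho>\<close> left for this
  pool.\<close>

lemma coreI_gen:
  assumes Q: "Q \<subseteq> Z2" and D: "D \<subseteq> {z \<in> Z. z < c}"
    and 1: "q * (card Q + card Z3) \<le> (\<Sum>z\<in>Q. pair_weight z) + (card G + 1) * (\<Sum>z\<in>D. w z) + r"
    and 2: "r + (\<Sum>z\<in>Z2 - Q. \<delta> z) \<le> \<rho>"
  shows core
proof -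
  have finQ: "finite Q" using Q Z_split(3) finite_subset by auto
  have "q * card (Z2 - Q) = (\<Sum>z\<in>Z2 - Q. q)" by simp
  also have "\<dots> \<le> (\<Sum>z\<in>Z2 - Q. pair_weight z + \<delta> z)" by (intro sum_mono) (auto elim: Z2_E)
  finally have 3: "q * card (Z2 - Q) \<le> (\<Sum>z\<in>Z2 - Q. pair_weight z) + (\<Sum>z\<in>Z2 - Q. \<delta> z)"
    by (simp add: sum.distrib)
  have "card Z = card Z2 + card Z3"
    unfolding Z_split(1) using Z_split by (intro card_Un_disjoint) auto
  moreover have "card Z2 = card (Z2 - Q) + card Q"
    using Q finQ card_mono[OF Z_split(3) Q] by (simp add: card_Diff_subset)
  ultimately have 4: "q * card Z = q * card (Z2 - Q) + q * (card Q + card Z3)"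
    by (simp add: algebra_simps)
  have 5: "(\<Sum>z\<in>Z2 - Q. pair_weight z) + (\<Sum>z\<in>Q. pair_weight z) \<le> (card G + 1) * (\<Sum>x\<in>G. w x)"
    using sum_pair_weight_le sum.subset_diff[OF Q Z_split(3), of pair_weight] by simp
  have "(\<Sum>z\<in>D. w z) \<le> (\<Sum>x\<in>{z \<in> Z. z < c}. w x)"
    using D finite_Z by (intro sum_mono2) auto
  then have 6: "(card G + 1) * (\<Sum>z\<in>D. w z) \<le> (card G + 1) * (\<Sum>x\<in>{z \<in> Z. z < c}. w x)"
    by (rule mult_le_mono2)
  show ?thesis unfolding core_def sum_A distrib_left using 1 2 3 4 5 6 by linarith
qed

text \<open>Here \<open>r\<close> is the total of \<open>\<delta>\<close> over
  \<open>Q \<union> Z3\<close>; \<open>sum_delta_le\<close> bounds this and the rest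
  together.\<close>

lemma coreI:
  assumes "Q \<subseteq> Z2" "D \<subseteq> {z \<in> Z. z < c}"
    and "q * (card Q + card Z3) \<le> (\<Sum>z\<in>Q. pair_weight z) + (card G + 1) * (\<Sum>z\<in>D. w z) + (\<Sum>z\<in>Q \<union> Z3. \<delta> z)"
  shows core
  using assms
proof (rule coreI_gen)
  have "(\<Sum>z\<in>Q \<union> Z3. \<delta> z) + (\<Sum>z\<in>Z2 - Q. \<delta> z) = (\<Sum>z\<in>(Q \<union> Z3) \<union> (Z2 - Q). \<delta> z)"
    using assms(1) Z_split finite_subset by (intro sum.union_disjoint[symmetric]) auto
  also have "(Q \<union> Z3) \<union> (Z2 - Q) = Z" using assms(1) Z_split(1) by auto
  finally show "(\<Sum>z\<in>Q \<union> Z3. \<delta> z) + (\<Sum>z\<in>Z2 - Q. \<delta> z) \<le> \<rho>" using sum_delta_le by simp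
qed

lemma core_no_cubics: "Z3 = {} \<Longrightarrow> core"
  using coreI[of "{}" "{}"] by simp


section \<open>Cubic monomials in one generator, and depth 3\<close>

lemma sub_Z:
  assumes "z \<in> Z" "N \<subseteq># rep z" "2 \<le> size N"
  shows "sum_mset N \<in> Z" "rep (sum_mset N) = N"
proof -
  have z: "z \<in> A \<union> Z" using assms by simp
  show "rep (sum_mset N) = N" by (rule rep_subset[OF z assms(2)])
  show "sum_mset N \<in> Z"
  proof (cases "N = rep z")
    case True then show ?thesis using rep(2)[OF z] assms(1) by simp
  next
    case False
    obtain K where K: "rep z = N + K" using assms(2) by (metis subset_mset.add_diff_inverse)
    then have "K \<noteq> {#}" using False by auto
    moreover have "N \<noteq> {#}" using assms(3) by auto
    ultimately show ?thesis using rep_part(5)[OF assms(1) K] assms(3) by blast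
  qed
qed

lemma power_part:
  assumes "z \<in> Z" "rep z = replicate_mset s x" "0 < k" "k < s"
  shows "k * x \<in> A" "rep (k * x) = replicate_mset k x" "q \<le> w (k * x) + w ((s - k) * x) + \<delta> z"
proof -
  have *: "rep z = replicate_mset k x + replicate_mset (s - k) x"
    using assms(2,4) by (intro multiset_eqI) simp
  have ne: "replicate_mset k x \<noteq> {#}" "replicate_mset (s - k) x \<noteq> {#}" using assms by auto
  show "k * x \<in> A" "rep (k * x) = replicate_mset k x" "q \<le> w (k * x) + w ((s - k) * x) + \<delta> z"
    using rep_part[OF assms(1) * ne] by auto
qed

text \<open>Pairing \<open>k x\<close> with \<open>(s - k) x\<close>. The second bound is needed when \<open>x\<close> is the only generator: there
  the loss at each \<open>k\<close> is charged to the position of \<open>k x\<close> modulo \<open>m\<close>.\<close>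
lemma power_sum:
  assumes z: "z \<in> Z" "rep z = replicate_mset s x"
  shows "(s - 1) * q \<le> 2 * (\<Sum>k\<in>{1..<s}. w (k * x)) + (s - 1) * \<delta> z" (is ?A)
    and "(s - 1) * q \<le> 2 * (\<Sum>k\<in>{1..<s}. w (k * x)) + \<rho>" (is ?B)
proof -
  let ?I = "{1..<s}"
  let ?p = "\<lambda>k. w (k * x) + w ((s - k) * x)"
  have "(\<Sum>k\<in>?I. w ((s - k) * x)) = (\<Sum>k\<in>?I. w (k * x))"
    by (rule sum.reindex_bij_witness[of _ "\<lambda>k. s - k" "\<lambda>k. s - k"]) auto
  then have two: "2 * (\<Sum>k\<in>?I. w (k * x)) = (\<Sum>k\<in>?I. ?p k)" by (simp add: sum.distrib)
  have "(\<Sum>k\<in>?I. q) \<le> (\<Sum>k\<in>?I. ?p k + \<delta> z)"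
    by (intro sum_mono power_part(3)[OF z]) auto
  then show ?A unfolding two by (simp add: sum.distrib)
  let ?J = "{k \<in> ?I. ?p k < q}"
  have "(\<Sum>k\<in>?I. q) \<le> (\<Sum>k\<in>?I. ?p k + (if ?p k < q then 1 else 0))"
  proof (rule sum_mono)
    fix k assume "k \<in> ?I"
    then have "q \<le> ?p k + \<delta> z" using power_part(3)[OF z, of k] by simp
    then show "q \<le> ?p k + (if ?p k < q then 1 else 0)" by (auto simp: \<delta>_def split: if_splits)
  qed
  then have le: "(s - 1) * q \<le> (\<Sum>k\<in>?I. ?p k) + card ?J"
    by (simp add: sum.distrib sum.If_cases Int_def)
  have zc: "z < c + m" using z(1) by (simp add: Z_def)
  have zs: "z = s * x" using rep(2)[of z] z by simp
  have ap: "apery (k * x)" if "k \<in> ?I" for k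
    using power_part(1)[OF z, of k] that by (simp add: A_def)
  have rp: "rep (k * x) = replicate_mset k x" if "k \<in> ?I" for k
    using power_part(2)[OF z, of k] that by simp
  have "card ?J \<le> card {..<\<rho>}"
  proof (rule card_inj_on_le)
    \<comment> \<open>The overshoot past \<open>c\<close> of the first term at or above
      \<open>c\<close> in the progression of step \<open>m\<close> from \<open>k * x\<close>. It
      determines the residue of \<open>k * x\<close>, hence \<open>k\<close>; where one is lost, the
      two overshoots of the pair add up to less than \<open>\<rho>\<close>.\<close>
    let ?h = "\<lambda>k. k * x + w (k * x) * m - c"
    show "inj_on ?h ?J"
    proof (rule inj_onI)
      fix k l assume kl: "k \<in> ?J" "l \<in> ?J" "?h k = ?h l"
      then have "k * x + w (k * x) * m = l * x + w (l * x) * m"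
        using c_le_w[of "k * x"] c_le_w[of "l * x"] by linarith
      then have "(k * x + w (k * x) * m) mod m = (l * x + w (l * x) * m) mod m" by simp
      then have "(k * x) mod m = (l * x) mod m" by simp
      then have "k * x = l * x" using ap[of k] ap[of l] kl apery_cong by blast
      then have "rep (k * x) = rep (l * x)" by (rule arg_cong)
      then have "replicate_mset k x = replicate_mset l x" using rp[of k] rp[of l] kl by (simp only: mem_Collect_eq)
      then have "size (replicate_mset k x) = size (replicate_mset l x)" by (rule arg_cong)
      then show "k = l" by simp
    qed
    show "?h ` ?J \<subseteq> {..<\<rho>}"
    proof
      fix h assume "h \<in> ?h ` ?J"
      then obtain k where k: "k \<in> ?I" "?p k < q" "h = ?h k" by auto
      have "(?p k + 1) * m \<le> q * m" using k(2) by (intro mult_le_mono1) simp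
      moreover have "k * x + (s - k) * x = z" using k(1) zs by (simp flip: add_mult_distrib)
      ultimately have "k * x + w (k * x) * m + ((s - k) * x + w ((s - k) * x) * m) + m < 2 * c + \<rho> + m"
        using zc c_eq by (simp add: algebra_simps)
      then show "h \<in> {..<\<rho>}" using k(3) c_le_w[of "(s - k) * x"] c_le_w[of "k * x"] by simp
    qed
  qed simp
  then show ?B using le unfolding two by simp
qed

text \<open>If \<open>s\<close> is the largest degree, \<open>Z3\<close> consists of the
  \<open>k * x\<close> with \<open>3 \<le> k \<le> s\<close>. The pair weight of
  \<open>2 * x\<close> and the weights of \<open>k * x\<close> for \<open>2 \<le> k < s\<close> form
  the pool, which \<open>power_sum\<close> bounds below.\<close>

lemma core_single:
  assumes pow: "\<And>z. z \<in> Z3 \<Longrightarrow> rep z = replicate_mset (size (rep z)) x"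
  shows core
proof (cases "Z3 = {}")
  case True then show ?thesis by (rule core_no_cubics)
next
  case False
  let ?s = "Max ((\<lambda>z. size (rep z)) ` Z3)"
  have fin: "finite ((\<lambda>z. size (rep z)) ` Z3)" using Z_split(4) by simp
  have "?s \<in> (\<lambda>z. size (rep z)) ` Z3" using False fin by (intro Max_in) auto
  then obtain u where u: "u \<in> Z3" "size (rep u) = ?s" by auto
  define s where "s = ?s"
  have uZ: "u \<in> Z" "rep u = replicate_mset s x" "3 \<le> s"
    using u pow[OF u(1)] by (auto simp: Z3_def s_def)
  have us: "u = s * x" using rep(2)[of u] uZ by simp
  have xG: "x \<in> G" using rep(1)[of u] uZ by (auto split: if_splits)
  then have x0: "0 < x" by (rule G_in_S)
  have kZ: "k * x \<in> Z \<and> rep (k * x) = replicate_mset k x" if "2 \<le> k" "k \<le> s" for k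
    using sub_Z[of u "replicate_mset k x"] uZ that by (simp add: subseteq_mset_def)
  have kc: "k * x \<in> A" if "2 \<le> k" "k < s" for k using power_part(1)[OF uZ(1,2), of k] that by simp
  have Z3: "Z3 = (\<lambda>k. k * x) ` {3..s}"
  proof
    show "Z3 \<subseteq> (\<lambda>k. k * x) ` {3..s}"
    proof
      fix z assume z: "z \<in> Z3"
      then have "size (rep z) \<le> s" unfolding s_def using fin by (intro Max_ge) auto
      moreover have "z = size (rep z) * x"
        using pow[OF z] rep(2)[of z] z by (metis UnCI Z3_def mem_Collect_eq sum_mset_replicate_mset of_nat_id)
      ultimately show "z \<in> (\<lambda>k. k * x) ` {3..s}" using z unfolding Z3_def by (intro image_eqI) auto
    qed
    show "(\<lambda>k. k * x) ` {3..s} \<subseteq> Z3" using kZ by (auto simp: Z3_def)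
  qed
  have inj: "inj_on (\<lambda>k. k * x) K" for K :: "nat set" using x0 by (auto simp: inj_on_def)
  have card: "card Z3 = s - 2" unfolding Z3 using inj by (simp add: card_image)
  have x2: "2 * x \<in> Z2" using kZ[of 2] uZ(3) by (simp add: Z2_def)
  have f2: "pair_weight (2 * x) = 2 * w x" using kZ[of 2] uZ(3) by (simp add: pair_weight_def)
  have fs: "(\<Sum>z\<in>{2 * x}. pair_weight z) = 2 * w x" by (simp add: f2)
  let ?D = "(\<lambda>k. k * x) ` {2..<s}"
  have D: "?D \<subseteq> {z \<in> Z. z < c}" using kZ kc by (auto simp: A_def)
  have sumD: "(\<Sum>z\<in>?D. w z) = (\<Sum>k\<in>{2..<s}. w (k * x))" using inj by (simp add: sum.reindex)
  have T: "(\<Sum>k\<in>{1..<s}. w (k * x)) = w x + (\<Sum>k\<in>{2..<s}. w (k * x))"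
    using uZ(3) by (subst sum.atLeast_Suc_lessThan) (auto simp: numeral_2_eq_2)
  have cards: "card {2 * x} + card Z3 = s - 1" using card uZ(3) by simp
  consider "2 \<le> card G" | "G = {x}"
  proof (cases "2 \<le> card G")
    case False
    moreover have "card G \<noteq> 0" using xG finite_G by auto
    ultimately have "card G = 1" by simp
    then have "G = {x}" using xG by (auto simp: card_1_singleton_iff)
    then show ?thesis using that by simp
  qed (use that in simp)
  then show ?thesis
  proof cases
    case 1
    \<comment> \<open>As \<open>card G + 1 \<ge> 3\<close>, a third copy of the weight sum
      \<open>X\<close> is available. It is at least \<open>s - 2\<close> and pays the loss
      \<open>B\<close> up to one \<open>\<delta> u\<close>.\<close>
    have arith: "V \<le> 2 * (a + X) + B \<Longrightarrow> B \<le> t + d \<Longrightarrow> t \<le> X \<Longrightarrow> 3 * X \<le> P \<Longrightarrow> d \<le> E \<Longrightarrow> V \<le> 2 * a + P + E"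
      for V a X B t d P E :: nat by (simp add: algebra_simps)
    have "s - 2 \<le> (\<Sum>k\<in>{2..<s}. w (k * x))"
    proof -
      have "(\<Sum>k\<in>{2..<s}. 1) \<le> (\<Sum>k\<in>{2..<s}. w (k * x))"
        by (rule sum_mono) (use kc w_pos in \<open>auto simp: Suc_leI\<close>)
      then show ?thesis by simp
    qed
    moreover have "3 * (\<Sum>k\<in>{2..<s}. w (k * x)) \<le> (card G + 1) * (\<Sum>k\<in>{2..<s}. w (k * x))"
      using 1 by (intro mult_le_mono1) simp
    moreover have "\<delta> u \<le> (\<Sum>z\<in>{2 * x} \<union> Z3. \<delta> z)"
      using u(1) Z_split(4) by (intro member_le_sum) auto
    moreover have "(s - 1) * \<delta> u \<le> (s - 2) + \<delta> u" using uZ(3) by (auto simp: \<delta>_def)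
    ultimately have "q * (card {2 * x} + card Z3)
        \<le> (\<Sum>z\<in>{2 * x}. pair_weight z) + (card G + 1) * (\<Sum>z\<in>?D. w z) + (\<Sum>z\<in>{2 * x} \<union> Z3. \<delta> z)"
      using power_sum(1)[OF uZ(1,2)] unfolding cards sumD T fs mult.commute[of q] by (intro arith)
    then show ?thesis by (rule coreI[rotated 2]) (use x2 D in auto)
  next
    \<comment> \<open>The factor is exactly 2, so the second bound spends all of
      \<open>\<rho>\<close>; this is possible because \<open>Z2\<close> is just
      \<open>{2 * x}\<close> and leaves no \<open>\<delta>\<close> to pay.\<close>
    case 2
    have "Z2 \<subseteq> {2 * x}" using 2 by (auto elim!: Z2_E)
    then have Z2: "Z2 = {2 * x}" using x2 by blast
    have "card G = 1" using 2 by simp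
    then have "q * (card {2 * x} + card Z3)
        \<le> (\<Sum>z\<in>{2 * x}. pair_weight z) + (card G + 1) * (\<Sum>z\<in>?D. w z) + \<rho>"
      using power_sum(2)[OF uZ(1,2)] unfolding cards sumD T fs mult.commute[of q] by simp
    then show ?thesis by (rule coreI_gen[rotated 2]) (use D Z2 in simp_all)
  qed
qed

text \<open>A decomposable below \<open>c\<close> is at least \<open>2 * m\<close>, hence has weight
  1. So monomials of degree at least 3 represent elements \<open>\<ge> c\<close> and have degree
  exactly 3. Counting their quadratic divisors gives
  \<open>3 * card Z3 \<le> (card G + 2) * card ?D\<close>, and pair weights of at least 4 on
  \<open>?D\<close> supply the rest.\<close>

lemma core_depth_3:
  assumes q: "q = 3"
  shows core
proof -
  let ?D = "{z \<in> Z. z < c}"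
  have Zge: "2 * m \<le> z" if "z \<in> Z" for z
  proof -
    obtain a b where "a \<in> S" "b \<in> S" "0 < a" "0 < b" "z = a + b"
      using \<open>z \<in> Z\<close> unfolding Z_def dec_def by blast
    then show ?thesis using m_le[of a] m_le[of b] by linarith
  qed
  have w1: "w z = 1" if "z \<in> ?D" for z
  proof -
    have "0 < w z" using that by (simp add: less_w_iff)
    moreover have "\<not> 1 < w z" unfolding less_w_iff using Zge[of z] that c_eq q by simp
    ultimately show ?thesis by simp
  qed
  have w2: "2 \<le> w a" if "z \<in> ?D" "a + m \<le> z" for a z
    using w_mono[of a z] w1[of z] that by simp
  have ge: "c \<le> z" if z: "z \<in> Z3" for z
  proof (rule ccontr)
    assume "\<not> c \<le> z"
    then have zD: "z \<in> ?D" using z by (simp add: Z3_def)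
    have "3 \<le> size (rep z)" using z by (simp add: Z3_def)
    then obtain x M where M: "rep z = {#x#} + M" "2 \<le> size M"
      by (cases "rep z") auto
    then have "M \<noteq> {#}" by auto
    then have M': "sum_mset M \<in> Z" "sum_mset M + m \<le> z" "sum_mset M \<in> A"
      using rep_part[of z M "{#x#}"] M z by (auto simp: Z3_def)
    then show False using w2[OF zD M'(2)] w1[of "sum_mset M"] by (simp add: A_def)
  qed
  have size3: "size (rep z) = 3" if z: "z \<in> Z3" for z
  proof (rule ccontr)
    assume "size (rep z) \<noteq> 3"
    then have "4 \<le> size (rep z)" using z by (simp add: Z3_def)
    then obtain x M where M: "rep z = {#x#} + M" "3 \<le> size M" by (cases "rep z") auto
    then have "M \<noteq> {#}" by auto
    then have "sum_mset M \<in> Z3" "sum_mset M \<in> A"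
      using rep_part[of z M "{#x#}"] M z by (auto simp: Z3_def)
    then show False using ge by (fastforce simp: A_def)
  qed
  have D2: "?D \<subseteq> Z2"
  proof
    fix z assume "z \<in> ?D"
    then have "z \<in> Z" "\<not> c \<le> z" by auto
    then show "z \<in> Z2" using ge Z_split(1) by blast
  qed
  have "4 \<le> pair_weight z" if z: "z \<in> ?D" for z
  proof -
    have "z \<in> Z2" using D2 z by blast
    then obtain x y where r: "rep z = {#x, y#}" "pair_weight z = w x + w y" by (rule Z2_E)
    then have "x + m \<le> z" "y + m \<le> z"
      using rep_part(4)[of z "{#x#}" "{#y#}"] rep_part(4)[of z "{#y#}" "{#x#}"] z by auto
    then show ?thesis using w2[OF z, of x] w2[OF z, of y] r(2) by simp
  qed
  then have f: "4 * card ?D \<le> (\<Sum>z\<in>?D. pair_weight z)"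
    using sum_mono[of ?D "\<lambda>_. 4" pair_weight] by simp
  have inj: "inj_on rep Z" by (intro inj_on_inverseI[of _ sum_mset]) (simp add: rep)
  have "(\<Sum>N\<in>rep ` Z3. \<Sum>g\<in>#N. 1) \<le> (card G + 2) * (\<Sum>M\<in>rep ` ?D. 1)"
  proof (rule shadow_sum_le[where W = "\<lambda>_. 1"])
    fix N g assume N: "N \<in> rep ` Z3" "g \<in># N"
    then obtain z where z: "z \<in> Z3" "N = rep z" by blast
    have *: "rep z = (N - {#g#}) + {#g#}" using N(2) z by simp
    have "size (N - {#g#}) = 2" using size3[OF z(1)] N(2) z(2) by (simp add: size_Diff_singleton)
    then have sz: "2 \<le> size (N - {#g#})" "N - {#g#} \<noteq> {#}" by auto
    have zZ: "z \<in> Z" using z by (simp add: Z3_def)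
    have "sum_mset (N - {#g#}) \<in> ?D" "rep (sum_mset (N - {#g#})) = N - {#g#}"
      using rep_part[OF zZ * sz(2)] sz(1) by (auto simp: A_def)
    then show "N - {#g#} \<in> rep ` ?D" by (intro image_eqI) auto
  next
    fix M assume "M \<in> rep ` ?D"
    then obtain z where z: "z \<in> Z2" "M = rep z" using D2 by blast
    then show "set_mset M \<subseteq> G \<and> size M = 2" using rep(1)[of z] by (simp add: Z2_def)
  next
    fix N assume "N \<in> rep ` Z3"
    then obtain z where z: "z \<in> Z3" "N = rep z" by blast
    then show "set_mset N \<subseteq> G" using rep(1)[of z] by (simp add: Z3_def)
  qed (simp_all add: finite_G finite_Z Z_split(4))
  moreover have "(\<Sum>N\<in>rep ` Z3. \<Sum>g\<in>#N. 1) = (\<Sum>N\<in>rep ` Z3. 3 :: nat)"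
    by (intro sum.cong refl) (auto simp: size3)
  moreover have "card (rep ` Z3) = card Z3" "card (rep ` ?D) = card ?D"
    using inj Z_split(1) by (auto intro!: card_image inj_on_subset[OF inj])
  ultimately have cubic: "3 * card Z3 \<le> (card G + 2) * card ?D" by simp
  have sumw: "(\<Sum>z\<in>?D. w z) = card ?D" by (simp add: w1)
  show ?thesis
  proof (rule coreI[OF D2 subset_refl])
    have three: "q * (card ?D + card Z3) = 3 * card ?D + 3 * card Z3" using q by simp
    have "(card G + 2) * card ?D = (card G + 1) * card ?D + card ?D" by simp
    then show "q * (card ?D + card Z3) \<le> (\<Sum>z\<in>?D. pair_weight z) + (card G + 1) * (\<Sum>z\<in>?D. w z) + (\<Sum>z\<in>?D \<union> Z3. \<delta> z)"
      unfolding sumw three using f cubic by linarith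
  qed
qed

section \<open>Depth at least 4\<close>

text \<open>The standard monomials of elements of \<open>Z\<close>, as a predicate on multisets so
  that a monomial can be named by its generators, as in \<open>{#x, x, y#}\<close>.\<close>

definition mon :: "nat multiset \<Rightarrow> bool" where
  "mon M \<longleftrightarrow> sum_mset M \<in> Z \<and> rep (sum_mset M) = M"

lemma mon_rep: "z \<in> Z \<Longrightarrow> mon (rep z)"
  by (simp add: mon_def rep)

lemma mon_subset:
  assumes "mon M" "N \<subseteq># M" "2 \<le> size N" shows "mon N"
  using sub_Z[of "sum_mset M" N] assms unfolding mon_def by simp

lemma delta_le: "\<delta> z \<le> 1"
  by (simp add: \<delta>_def)

lemma cubic1:
  assumes "mon {#a, b, d#}"
  shows "d \<in> G" "d \<in> A" "a + b \<in> A" "rep (a + b) = {#a, b#}"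
    "q \<le> w d + w (a + b) + \<delta> (a + b + d)" "a + b + m \<le> a + b + d" "d + m \<le> a + b + d"
proof -
  have z: "a + b + d \<in> Z" "rep (a + b + d) = {#a, b#} + {#d#}" "rep (a + b + d) = {#d#} + {#a, b#}"
    using assms by (auto simp: mon_def add.assoc add.commute add.left_commute)
  show "a + b \<in> A" "rep (a + b) = {#a, b#}" "q \<le> w d + w (a + b) + \<delta> (a + b + d)"
    "a + b + m \<le> a + b + d"
    using rep_part[OF z(1,2)] by (auto simp: add.commute)
  show "d \<in> A" "d + m \<le> a + b + d" using rep_part[OF z(1,3)] by auto
  show "d \<in> G" using rep(1)[of "a + b + d"] z by auto
qed

lemma cubic:
  assumes "mon {#a, b, d#}"
  shows "a \<in> G" "b \<in> G" "d \<in> G" "a + b \<in> A" "a + d \<in> A" "b + d \<in> A"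
    "rep (a + b) = {#a, b#}" "rep (a + d) = {#a, d#}" "rep (b + d) = {#b, d#}"
    "q \<le> w a + w (b + d) + \<delta> (a + b + d)" "q \<le> w b + w (a + d) + \<delta> (a + b + d)"
    "q \<le> w d + w (a + b) + \<delta> (a + b + d)"
proof -
  have p: "mon {#a, d, b#}" "mon {#b, d, a#}" using assms by (simp_all add: add_mset_commute)
  have e: "a + d + b = a + b + d" "b + d + a = a + b + d" by simp_all
  show "a \<in> G" "b \<in> G" "d \<in> G" "a + b \<in> A" "a + d \<in> A" "b + d \<in> A"
    "rep (a + b) = {#a, b#}" "rep (a + d) = {#a, d#}" "rep (b + d) = {#b, d#}"
    "q \<le> w a + w (b + d) + \<delta> (a + b + d)" "q \<le> w b + w (a + d) + \<delta> (a + b + d)"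
    "q \<le> w d + w (a + b) + \<delta> (a + b + d)"
    using cubic1[OF assms] cubic1[OF p(1)] cubic1[OF p(2)] unfolding e by blast+
qed

lemma G_A: "x \<in> G \<Longrightarrow> x \<in> A" using A_eq by auto

lemma w_add_less:
  assumes "a + b \<in> A" "a \<in> G" "b \<in> G"
  shows "w (a + b) < w a"
  using w_mono[of a "a + b"] m_le[of b] G_in_S[OF assms(3)] assms(1) by (simp add: A_def)

text \<open>A generator \<open>z\<close> outside the listed monomials brings two new elements,
  \<open>z\<close> and \<open>z + u\<close> for a cofactor \<open>u\<close>. As
  \<open>w (z + u) < w z\<close>, they weigh at least \<open>2 + 1\<close>.\<close>

lemma extra_generator:
  assumes "mon M" "size M = 3" "z \<in># M"
    and "set xs \<subseteq> A" "distinct (map rep xs)" "\<forall>a\<in>set xs. z \<notin># rep a"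
  shows "sum_list (map w xs) + 3 \<le> (\<Sum>x\<in>A. w x)"
proof -
  obtain N where N: "M = add_mset z N" using assms(3) by (metis insert_DiffM)
  then obtain u v where "N = {#u, v#}" using assms(2) size_2E[of N] by auto
  then have c: "mon {#z, u, v#}" using assms(1) N by simp
  note cu = cubic[OF c]
  have "w (z + u) < w z" by (rule w_add_less) (use cu in auto)
  moreover have "0 < w (z + u)" using cu by (simp add: w_pos)
  moreover have "sum_list (map w (z # (z + u) # xs)) \<le> (\<Sum>x\<in>A. w x)"
  proof (rule distinct_sum_w_le)
    have "rep z \<notin> rep ` set xs" "rep (z + u) \<notin> rep ` set xs"
      using assms(6) rep_G[of z] cu by fastforce+
    then show "distinct (map rep (z # (z + u) # xs))"
      using assms(5) rep_G[of z] cu by simp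
    show "set (z # (z + u) # xs) \<subseteq> A" using assms(4) cu G_A by simp
  qed
  ultimately show ?thesis by simp
qed


lemma mon_pair:
  assumes "mon {#a, b, d#}"
  shows "a + b \<in> Z2" "a + b < c" "pair_weight (a + b) = w a + w b" "0 < w (a + b)"
proof -
  have "mon {#a, b#}" using mon_subset[OF assms, of "{#a, b#}"] by simp
  then have r: "a + b \<in> Z" "rep (a + b) = {#a, b#}" by (simp_all add: mon_def)
  show "a + b \<in> Z2" "pair_weight (a + b) = w a + w b" using r by (simp_all add: Z2_def pair_weight_def)
  have "a + b \<in> A" using cubic[OF assms] by simp
  then show "a + b < c" "0 < w (a + b)" by (simp_all add: A_def w_pos)
qed

text \<open>The three generators and their pairwise sums form three complementary pairs, each of
  weight at least \<open>q - 1\<close>; then \<open>q + 3 * (q - 1) \<le> 12\<close>, impossible for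
  \<open>q \<ge> 4\<close>.\<close>

lemma no_three_distinct:
  assumes q: "4 \<le> q" and bound: "q + (\<Sum>a\<in>A. w a) \<le> 12"
    and c: "mon {#x, y, z#}" and ne: "x \<noteq> y" "x \<noteq> z" "y \<noteq> z"
  shows False
proof -
  note cu = cubic[OF c]
  have "sum_list (map w [x, y, z, x + y, x + z, y + z]) \<le> (\<Sum>a\<in>A. w a)"
  proof (rule distinct_sum_w_le)
    show "distinct (map rep [x, y, z, x + y, x + z, y + z])"
      using cu(1-3,7-9) ne by (simp add: rep_G doubleton_mset_eq_iff)
  qed (use cu G_A in simp)
  then show False using cu(10-12) delta_le[of "x + y + z"] q bound by simp
qed

text \<open>What a cubic still demands once its own \<open>\<delta>\<close> is deducted; the 4 is
  \<open>q\<close>. Nonstandard monomials demand nothing, so all four cubics in \<open>x\<close>,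
  \<open>y\<close> can be summed uniformly.\<close>

definition cost :: "nat multiset \<Rightarrow> nat" where
  "cost M = (if mon M then 4 - \<delta> (sum_mset M) else 0)"

lemma cost_le:
  assumes "q = 4"
  shows "cost {#a, b, d#} \<le> w a + w (b + d)" "cost {#a, b, d#} \<le> w b + w (a + d)"
    "cost {#a, b, d#} \<le> w d + w (a + b)"
  using cubic(10-12)[of a b d] assms by (auto simp: cost_def add.assoc add.left_commute)

lemma cost_bounds: "cost M \<le> 4" "mon M \<Longrightarrow> 3 \<le> cost M" "\<not> mon M \<Longrightarrow> cost M = 0"
  using delta_le[of "sum_mset M"] by (auto simp: cost_def)

lemma extend_distinct:
  assumes "distinct (map rep xs)" "\<forall>a\<in>set xs. size (rep a) \<le> 2" "set xs \<subseteq> A"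
    and "t \<in> A" "size (rep t) = 3"
  shows "sum_list (map w xs) + w t \<le> (\<Sum>a\<in>A. w a)"
proof -
  have "rep t \<notin> rep ` set xs" using assms(2,5) by fastforce
  then have "sum_list (map w (t # xs)) \<le> (\<Sum>a\<in>A. w a)"
    using assms by (intro distinct_sum_w_le) auto
  then show ?thesis by simp
qed

text \<open>The cubic case \<open>q = 4\<close> with all of \<open>3x\<close>, \<open>2x + y\<close>, \<open>x + 2y\<close>, \<open>3y\<close> in \<open>Z\<close> is not
  decided by these weights alone: it needs that \<open>m\<close> is at least the number of known Apery elements.\<close>
lemma rho_large:
  assumes q4: "q = 4" and G: "card G = 2" and Z: "7 \<le> card Z"
    and xy: "x \<noteq> y" "mon {#x, x, x#}" "mon {#y, y, y#}" and w: "w x \<le> 2"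
  shows "4 \<le> \<rho>" "w y \<le> 2 \<Longrightarrow> 7 \<le> \<rho>"
proof -
  \<comment> \<open>One for \<open>0\<close>, two generators, seven decomposables.\<close>
  have "10 \<le> m" using card_le_m G Z by simp
  moreover have "c + \<rho> = 4 * m" using c_eq q4 by simp
  moreover have "3 * x < c + m" "3 * y < c + m" using xy by (simp_all add: mon_def Z_def)
  moreover have "c \<le> x + 2 * m" using w less_w_iff[of 2 x] by linarith
  ultimately show "4 \<le> \<rho>" by linarith
  assume "w y \<le> 2"
  then have "c \<le> y + 2 * m" using less_w_iff[of 2 y] by linarith
  \<comment> \<open>The larger of \<open>x\<close>, \<open>y\<close> exceeds
    \<open>c - 2 * m\<close>; its triple lies below \<open>c + m\<close>, which yields
    \<open>m + 3 < 2 * \<rho>\<close>.\<close>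
  then show "7 \<le> \<rho>" using \<open>10 \<le> m\<close> \<open>c + \<rho> = 4 * m\<close> \<open>3 * x < c + m\<close> \<open>3 * y < c + m\<close>
    \<open>c \<le> x + 2 * m\<close> xy(1) by linarith
qed

text \<open>The quadratic divisors of the standard cubics serve both as \<open>Q\<close> and as
  \<open>D\<close>. The cases record which cubics are standard; only if all four are and
  \<open>G = {x, y}\<close> can the weights fall short, and then \<open>rho_large\<close>
  helps.\<close>

lemma core_two_generators:
  assumes q4: "q = 4" and bound: "(\<Sum>a\<in>A. w a) \<le> 8" and xy: "x \<noteq> y" "x \<in> G" "y \<in> G"
    and Z3: "\<And>z. z \<in> Z3 \<Longrightarrow> rep z \<in> {{#x, x, x#}, {#x, x, y#}, {#x, y, y#}, {#y, y, y#}}"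
    and base: "mon {#x, x, y#} \<or>
      mon {#x, x, x#} \<and> mon {#y, y, y#} \<and> \<not> mon {#x, x, y#} \<and> \<not> mon {#x, y, y#}"
  shows core
proof -
  let ?M = "{{#x, x, x#}, {#x, x, y#}, {#x, y, y#}, {#y, y, y#}}"
  define c1 c2 c3 c4 where "c1 = cost {#x, x, x#}" and "c2 = cost {#x, x, y#}"
    and "c3 = cost {#x, y, y#}" and "c4 = cost {#y, y, y#}"
  note c_defs = c1_def c2_def c3_def c4_def
  have "(\<Sum>M\<in>?M. cost M) = c1 + c2 + c3 + c4"
    using xy(1) by (simp add: c_defs add_eq_conv_ex)
  have cardG: "2 \<le> card G"
    using card_mono[OF finite_G, of "{x, y}"] xy by simp
  have inj: "inj_on rep Z3" by (intro inj_on_inverseI[of _ sum_mset]) (simp add: rep Z3_def)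
  have "4 * card Z3 = (\<Sum>z\<in>Z3. cost (rep z)) + (\<Sum>z\<in>Z3. \<delta> z)"
  proof -
    have "cost (rep z) + \<delta> z = 4" if "z \<in> Z3" for z
      using that mon_rep[of z] delta_le[of z] by (simp add: cost_def rep Z3_def)
    then have "(\<Sum>z\<in>Z3. cost (rep z) + \<delta> z) = (\<Sum>z\<in>Z3. 4)" by (rule sum.cong[OF refl])
    then show ?thesis by (simp add: sum.distrib)
  qed
  moreover have "(\<Sum>z\<in>Z3. cost (rep z)) = (\<Sum>M\<in>rep ` Z3. cost M)"
    by (simp add: sum.reindex[OF inj])
  moreover have "(\<Sum>M\<in>rep ` Z3. cost M) \<le> (\<Sum>M\<in>?M. cost M)"
    using Z3 by (intro sum_mono2) auto
  ultimately have cost: "4 * card Z3 \<le> c1 + c2 + c3 + c4 + (\<Sum>z\<in>Z3. \<delta> z)"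
    using \<open>(\<Sum>M\<in>?M. cost M) = c1 + c2 + c3 + c4\<close> by simp
  have fin: core if Q: "Q \<subseteq> Z2" "Q \<subseteq> {z \<in> Z. z < c}" and k: "k \<le> card G + 1"
    and le: "4 * card Q + (c1 + c2 + c3 + c4) \<le> (\<Sum>z\<in>Q. pair_weight z) + k * (\<Sum>z\<in>Q. w z)" for Q k
  proof (rule coreI[OF Q])
    have "(\<Sum>z\<in>Z3. \<delta> z) \<le> (\<Sum>z\<in>Q \<union> Z3. \<delta> z)"
      using Q(1) Z_split finite_subset by (intro sum_mono2) auto
    moreover have "k * (\<Sum>z\<in>Q. w z) \<le> (card G + 1) * (\<Sum>z\<in>Q. w z)" using k by (rule mult_le_mono1)
    moreover have "q * (card Q + card Z3) = 4 * card Q + 4 * card Z3" using q4 by simp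
    ultimately show "q * (card Q + card Z3)
        \<le> (\<Sum>z\<in>Q. pair_weight z) + (card G + 1) * (\<Sum>z\<in>Q. w z) + (\<Sum>z\<in>Q \<union> Z3. \<delta> z)"
      using le cost by linarith
  qed
  have Z2D: "z \<in> {z \<in> Z. z < c}" if "z \<in> Z2" "z < c" for z using that by (simp add: Z2_def)
  have ne: "x + x \<noteq> x + y" "x + x \<noteq> y + y" "x + y \<noteq> y + y" using xy(1) by auto
  note costs = cost_le[OF q4, of x x x, folded c_defs] cost_le[OF q4, of x x y, folded c_defs]
    cost_le[OF q4, of x y y, folded c_defs] cost_le[OF q4, of y y y, folded c_defs]
    cost_bounds(1)[of "{#x, x, x#}", folded c_defs] cost_bounds(1)[of "{#x, x, y#}", folded c_defs]
    cost_bounds(1)[of "{#x, y, y#}", folded c_defs] cost_bounds(1)[of "{#y, y, y#}", folded c_defs]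
  note mons = cost_bounds(2)[of "{#x, x, x#}", folded c_defs] cost_bounds(2)[of "{#x, x, y#}", folded c_defs]
    cost_bounds(2)[of "{#x, y, y#}", folded c_defs] cost_bounds(2)[of "{#y, y, y#}", folded c_defs]
  note nomons = cost_bounds(3)[of "{#x, x, x#}", folded c_defs] cost_bounds(3)[of "{#x, x, y#}", folded c_defs]
    cost_bounds(3)[of "{#x, y, y#}", folded c_defs] cost_bounds(3)[of "{#y, y, y#}", folded c_defs]
  consider (A1) "mon {#x, x, y#}" "\<not> mon {#x, y, y#}" "\<not> mon {#y, y, y#}"
    | (B) "mon {#x, x, x#}" "mon {#y, y, y#}" "\<not> mon {#x, x, y#}" "\<not> mon {#x, y, y#}"
    | (A2) "mon {#x, x, y#}" "mon {#x, y, y#} \<or> mon {#y, y, y#}"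
    using base by blast
  then show ?thesis
  proof cases
    case A1
    have m: "mon {#x, y, x#}" using A1(1) by (simp add: add_mset_commute)
    note p = mon_pair[OF A1(1)] mon_pair[OF m]
    have z: "c3 = 0" "c4 = 0" "3 \<le> c2" "c1 = 0 \<or> 3 \<le> c1" using nomons mons A1 by auto
    have "8 + (c1 + c2) \<le> 2 * w x + (w x + w y) + 3 * (w (x + x) + w (x + y))"
      using z(4) unfolding distrib_left
    proof
      assume "c1 = 0"
      then show "8 + (c1 + c2) \<le> 2 * w x + (w x + w y) + (3 * w (x + x) + 3 * w (x + y))"
        using costs(4,6) z(3) p(4,8) by linarith
    next
      assume "3 \<le> c1"
      then show "8 + (c1 + c2) \<le> 2 * w x + (w x + w y) + (3 * w (x + x) + 3 * w (x + y))"
        using costs(1,4,6) z(3) p(4,8) by linarith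
    qed
    moreover have "(\<Sum>z\<in>{x + x, x + y}. pair_weight z) = 2 * w x + (w x + w y)" "card {x + x, x + y} = 2"
      "(\<Sum>z\<in>{x + x, x + y}. w z) = w (x + x) + w (x + y)"
      using p ne by simp_all
    ultimately show ?thesis
      using p Z2D z(1,2) cardG by (intro fin[of "{x + x, x + y}" 3]) simp_all
  next
    case B
    note p = mon_pair[OF B(1)] mon_pair[OF B(2)]
    have z: "c2 = 0" "c3 = 0" "3 \<le> c1" "3 \<le> c4" using nomons mons B by auto
    have "8 + (c1 + c4) \<le> 2 * w x + 2 * w y + 3 * (w (x + x) + w (y + y))"
      unfolding distrib_left using costs(1,10) z p(4,8) by linarith
    moreover have "(\<Sum>z\<in>{x + x, y + y}. pair_weight z) = 2 * w x + 2 * w y" "card {x + x, y + y} = 2"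
      "(\<Sum>z\<in>{x + x, y + y}. w z) = w (x + x) + w (y + y)"
      using p ne by simp_all
    ultimately show ?thesis
      using p Z2D z(1,2) cardG by (intro fin[of "{x + x, y + y}" 3]) simp_all
  next
    case A2
    have m: "mon {#x, y, x#}" using A2(1) by (simp add: add_mset_commute)
    obtain v where v: "mon {#y, y, v#}" using A2(2) by (auto simp: add_mset_commute)
    note p = mon_pair[OF A2(1)] mon_pair[OF m] mon_pair[OF v]
    let ?Q = "{x + x, x + y, y + y}"
    let ?xs = "[x, y, x + x, x + y, y + y]"
    define T where "T = sum_list (map w ?xs)"
    have T: "T = w x + w y + w (x + x) + w (x + y) + w (y + y)" by (simp add: T_def)
    have xs: "distinct (map rep ?xs)" "set ?xs \<subseteq> A"
      using cubic[OF A2(1)] cubic[OF v] xy G_A by (simp_all add: rep_G doubleton_mset_eq_iff)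
    have T8: "T \<le> 8" using distinct_sum_w_le[OF xs] bound unfolding T_def by simp
    have X: "w (x + x) < w x" "w (x + y) < w x" "w (x + y) < w y" "w (y + y) < w y"
      using w_add_less[of x x] w_add_less[of x y] w_add_less[of y x] w_add_less[of y y] xs(2) xy
      by (simp_all add: add.commute)
    have Q: "?Q \<subseteq> Z2" "?Q \<subseteq> {z \<in> Z. z < c}" using p Z2D by auto
    have sums: "card ?Q = 3" "(\<Sum>z\<in>?Q. pair_weight z) = 3 * w x + 3 * w y"
      "(\<Sum>z\<in>?Q. w z) = w (x + x) + w (x + y) + w (y + y)"
      using p ne by auto
    show ?thesis
    proof (cases "mon {#x, x, x#} \<and> mon {#x, y, y#} \<and> mon {#y, y, y#}")
      case False
      then have "c1 = 0 \<or> c3 = 0 \<or> c4 = 0" using nomons by blast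
      \<comment> \<open>At most three cubics cost anything. Either \<open>T = 8\<close> and each
        costs at most 4, or the weights are minimal, \<open>T = 7\<close>, and each costs at most
        3.\<close>
      then have "12 + (c1 + c2 + c3 + c4) \<le> 3 * T"
      proof (cases "T = 8")
        case False
        then have "w x = 2" "w y = 2" "w (x + x) = 1" "w (x + y) = 1" "w (y + y) = 1"
          using T T8 X p(4,8,12) by linarith+
        then have "c1 \<le> 3" "c2 \<le> 3" "c3 \<le> 3" "c4 \<le> 3" "T = 7" using costs(1,4,8,10) T by simp_all
        then show ?thesis using \<open>c1 = 0 \<or> c3 = 0 \<or> c4 = 0\<close> by linarith
      next
        case True
        then show ?thesis using \<open>c1 = 0 \<or> c3 = 0 \<or> c4 = 0\<close> costs(13-16) by linarith
      qed
      then have "4 * card ?Q + (c1 + c2 + c3 + c4) \<le> (\<Sum>z\<in>?Q. pair_weight z) + 3 * (\<Sum>z\<in>?Q. w z)"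
        unfolding sums T by simp
      then show ?thesis using cardG by (intro fin[OF Q]) auto
    next
      case True
      show ?thesis
      proof (cases "3 \<le> card G")
        case True
        then have "G \<noteq> {x, y}" using xy(1) by auto
        then obtain z where z: "z \<in> G" "z \<noteq> x" "z \<noteq> y" using xy by auto
        \<comment> \<open>The weight of a third generator forces \<open>T = 7\<close>, and the
          factor \<open>card G + 1\<close> is now at least 4.\<close>
        have "sum_list (map w (z # ?xs)) \<le> (\<Sum>a\<in>A. w a)"
          using xs z cubic[OF A2(1)] cubic[OF v] xy G_A
          by (intro distinct_sum_w_le) (simp_all add: rep_G)
        then have "T + w z \<le> 8" using bound by (simp add: T_def)
        moreover have "0 < w z" using z(1) by (simp add: G_A w_pos)
        ultimately have "w x = 2" "w y = 2" "w (x + x) = 1" "w (x + y) = 1" "w (y + y) = 1"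
          using T X p(4,8,12) by linarith+
        then have "4 * card ?Q + (c1 + c2 + c3 + c4) \<le> (\<Sum>z\<in>?Q. pair_weight z) + 4 * (\<Sum>z\<in>?Q. w z)"
          using costs(1,4,8,10) unfolding sums by simp
        then show ?thesis using \<open>3 \<le> card G\<close> by (intro fin[OF Q]) auto
      next
        case False
        then have G2: "card G = 2" using cardG by simp
        then have G: "G = {x, y}"
          using card_subset_eq[OF finite_G, of "{x, y}"] xy by simp
        have "Z2 \<subseteq> ?Q"
        proof
          fix z assume "z \<in> Z2"
          then obtain a b where "z = a + b" "a \<in> G" "b \<in> G" by (rule Z2_E)
          then show "z \<in> ?Q" unfolding G by (auto simp: add.commute)
        qed
        then have Z2: "Z2 = ?Q" using Q(1) by blast
        have "sum_mset ` ?M \<subseteq> Z3"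
          using True A2(1) unfolding mon_def Z3_def by (auto simp: add.assoc)
        then have "card (sum_mset ` ?M) \<le> card Z3" by (rule card_mono[OF Z_split(4)])
        moreover have "card (sum_mset ` ?M) = 4"
        proof -
          have "inj_on sum_mset ?M" by (rule inj_on_inverseI[of _ rep]) (use True A2(1) in \<open>auto simp: mon_def\<close>)
          moreover have "card ?M = 4" using xy(1) by (simp add: add_eq_conv_ex)
          ultimately show ?thesis by (simp only: card_image)
        qed
        moreover have "card (rep ` Z3) \<le> card ?M" using Z3 by (intro card_mono) auto
        moreover have "card ?M \<le> 4" by (simp add: card_insert_if)
        ultimately have Z34: "card Z3 = 4" using card_image[OF inj] by simp
        have "card Z = card Z2 + card Z3"
          unfolding Z_split(1) using Z_split by (intro card_Un_disjoint) auto
        then have Z7: "7 \<le> card Z" using Z34 Z2 sums(1) by simp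
        \<comment> \<open>The demand is \<open>4 * (3 + 4)\<close> against a pool of
          \<open>3 * T\<close>, where \<open>T\<close> is 7 or 8; the missing 7 or 4 comes from
          \<open>\<rho>\<close>.\<close>
        have "28 \<le> 3 * T + \<rho>"
        proof -
          have "w x \<le> 2 \<or> w y \<le> 2" using T T8 p(4,8,12) by linarith
          then have "4 \<le> \<rho>"
            using rho_large(1)[OF q4 G2 Z7, of x y] rho_large(1)[OF q4 G2 Z7, of y x] True xy(1) by auto
          moreover have "7 \<le> \<rho>" if "T \<noteq> 8"
          proof -
            have "w x \<le> 2" "w y \<le> 2" using that T T8 X p(4,8,12) by linarith+
            then show ?thesis using rho_large(2)[OF q4 G2 Z7, of x y] True xy(1) by auto
          qed
          moreover have "7 \<le> T" using T X p(4,8,12) by linarith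
          ultimately show ?thesis using T8 by (cases "T = 8") auto
        qed
        moreover have "q * (card ?Q + card Z3) = 28" using q4 sums(1) Z34 by simp
        moreover have "(\<Sum>z\<in>?Q. pair_weight z) + (card G + 1) * (\<Sum>z\<in>?Q. w z) = 3 * T"
          unfolding sums G2 T by simp
        ultimately show ?thesis
          using Z2 by (intro coreI_gen[OF Q, of \<rho>]) simp_all
      qed
    qed
  qed
qed


lemma mon_cubic_sub:
  assumes "z \<in> Z3" "g \<in># rep z"
  obtains u v where "mon {#g, u, v#}" "{#g, u, v#} \<subseteq># rep z"
proof -
  have z: "z \<in> Z" "3 \<le> size (rep z)" using assms(1) by (simp_all add: Z3_def)
  obtain N where N: "rep z = add_mset g N" using assms(2) by (metis insert_DiffM)
  then have "\<exists>u K. N = add_mset u K" using z(2) by (cases N) auto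
  then obtain u K where K: "N = add_mset u K" by blast
  then have "\<exists>v L. K = add_mset v L" using z(2) N by (cases K) auto
  then obtain v L where L: "K = add_mset v L" by blast
  have sub: "{#g, u, v#} \<subseteq># rep z" unfolding N K L by simp
  then have "mon {#g, u, v#}" using mon_subset[OF mon_rep[OF z(1)] sub] by simp
  then show thesis using that sub by blast
qed

text \<open>Adding a generator strictly lowers the weight, so going back from the cubic to
  \<open>a + b\<close> and to \<open>a\<close> the weights are at least 1, 2, 3.\<close>

lemma cubic_below_c:
  assumes t: "mon {#a, b, d#}" "a + b + d < c"
  shows "2 \<le> w (a + b)" "3 \<le> w a" "3 \<le> w b" "a + b + d \<in> A" "rep (a + b + d) = {#a, b, d#}"
    "0 < w (a + b + d)"
proof -
  note cu = cubic[OF t(1)] cubic1[OF t(1)]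
  show A: "a + b + d \<in> A" using t A_eq by (auto simp: mon_def add.assoc)
  then show p: "0 < w (a + b + d)" by (rule w_pos)
  have "w (a + b + d) < w (a + b)" using w_mono[OF _ t(2)] cu by simp
  then show 2: "2 \<le> w (a + b)" using p by simp
  show "rep (a + b + d) = {#a, b, d#}" using t(1) by (simp add: mon_def add.assoc)
  show "3 \<le> w a" using w_add_less[of a b] cu 2 by simp
  show "3 \<le> w b" using w_add_less[of b a] cu 2 by (simp add: add.commute)
qed

lemma core_depth_ge_4:
  assumes q: "4 \<le> q" and bound: "q + (\<Sum>a\<in>A. w a) \<le> 12"
  shows core
proof -
  \<comment> \<open>The generators dividing some standard cubic. If there is at most one,
    \<open>core_single\<close> applies; two of them force \<open>q = 4\<close> and total weight at
    most 8.\<close>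
  define V where "V = {g. \<exists>M. mon M \<and> size M = 3 \<and> g \<in># M}"
  show ?thesis
  proof (cases "\<exists>x. V \<subseteq> {x}")
    case True
    then obtain x where x: "V \<subseteq> {x}" by blast
    show ?thesis
    proof (rule core_single[of x])
      fix z assume z: "z \<in> Z3"
      have "g = x" if g: "g \<in># rep z" for g
      proof -
        obtain u v where "mon {#g, u, v#}" using mon_cubic_sub[OF z g] by blast
        then have "g \<in> V" unfolding V_def by (intro CollectI exI[of _ "{#g, u, v#}"]) simp
        then show ?thesis using x by blast
      qed
      then show "rep z = replicate_mset (size (rep z)) x"
        by (intro set_mset_subset_singletonD) blast
    qed
  next
    case False
    then obtain x' where x': "x' \<in> V" by blast
    then obtain y' where y': "y' \<in> V" "x' \<noteq> y'" using False by blast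
    have cub: "\<exists>u v. mon {#g, u, v#}" if "g \<in> V" for g
    proof -
      obtain M where M: "mon M" "size M = 3" "g \<in># M" using \<open>g \<in> V\<close> by (auto simp: V_def)
      then obtain N where N: "M = add_mset g N" by (metis insert_DiffM)
      then have "size N = 2" using M(2) by simp
      then obtain u v where "N = {#u, v#}" by (rule size_2E)
      then show ?thesis using M(1) N by blast
    qed
    have "(\<exists>x y. x \<noteq> y \<and> mon {#x, x, y#}) \<or>
      (\<exists>x y. x \<noteq> y \<and> mon {#x, x, x#} \<and> mon {#y, y, y#} \<and> \<not> mon {#x, x, y#} \<and> \<not> mon {#x, y, y#})"
    proof (cases "\<exists>x y. x \<noteq> y \<and> mon {#x, x, y#}")
      case none: False
      \<comment> \<open>The factors of a cubic containing \<open>g\<close> can be neither all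
        distinct nor exactly two equal, so it is the cube of \<open>g\<close>.\<close>
      have "mon {#g, g, g#}" if gV: "g \<in> V" for g
      proof -
        obtain u v where uv: "mon {#g, u, v#}" using cub[OF gV] by blast
        have "mon {#g, v, u#}" "mon {#u, v, g#}" using uv by (simp_all add: add_mset_commute)
        then show ?thesis using none uv no_three_distinct[OF q bound uv] by metis
      qed
      moreover have "\<not> mon {#x', y', y'#}"
        using none y'(2) by (metis add_mset_commute)
      ultimately show ?thesis using x' y' none by blast
    qed simp
    then obtain x y where xy: "x \<noteq> y" and base: "mon {#x, x, y#} \<or>
      mon {#x, x, x#} \<and> mon {#y, y, y#} \<and> \<not> mon {#x, x, y#} \<and> \<not> mon {#x, y, y#}" by blast
    \<comment> \<open>\<open>p\<close> completes \<open>x\<close>, \<open>y\<close>,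
      \<open>x + x\<close> to two complementary pairs: it is \<open>x + y\<close> when
      \<open>{#x, x, y#}\<close> is standard and \<open>y + y\<close> for the two cubes. The total
      weight is then at least \<open>2 * q - 2\<close>.\<close>
    obtain p where p: "p = x + y \<and> mon {#x, x, y#} \<and> rep p = {#x, y#} \<or>
        p = y + y \<and> \<not> mon {#x, x, y#} \<and> \<not> mon {#x, y, y#} \<and> rep p = {#y, y#}"
      and pA: "p \<in> A" and py: "w p < w y" and xA: "x + x \<in> A" and xr: "rep (x + x) = {#x, x#}"
      and xyG: "x \<in> G" "y \<in> G" and p1: "q \<le> w x + w (x + x) + 1 \<and> q \<le> w y + w p + 1 \<or>
        q \<le> w x + w p + 1 \<and> q \<le> w y + w (x + x) + 1"
    proof (cases "mon {#x, x, y#}")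
      case True
      note cu = cubic[OF True]
      have "q \<le> w x + w (x + y) + 1" "q \<le> w y + w (x + x) + 1"
        using cu(11,12) delta_le[of "x + x + y"] by linarith+
      moreover have "w (x + y) < w y" using w_add_less[of y x] cu(3,5,1) by (simp add: add.commute)
      ultimately show thesis using that[of "x + y"] True cu by blast
    next
      case False
      then have m: "mon {#x, x, x#}" "mon {#y, y, y#}" "\<not> mon {#x, y, y#}" using base by auto
      note cu = cubic[OF m(1)] cubic[OF m(2)]
      have "q \<le> w x + w (x + x) + 1" "q \<le> w y + w (y + y) + 1"
        using cu(10,22) delta_le[of "x + x + x"] delta_le[of "y + y + y"] by linarith+
      moreover have "w (y + y) < w y" using w_add_less[of y y] cu by simp
      ultimately show thesis using that[of "y + y"] False m cu by blast
    qed
    let ?xs = "[x, y, x + x, p]"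
    have rp: "rep p = {#x, y#} \<or> rep p = {#y, y#}" using p by blast
    have xs: "distinct (map rep ?xs)" "set ?xs \<subseteq> A"
    proof -
      show "distinct (map rep ?xs)"
        using rp by (elim disjE) (use xr xyG xy in \<open>simp_all add: rep_G doubleton_mset_eq_iff\<close>)
      show "set ?xs \<subseteq> A" using xyG xA pA G_A by simp
    qed
    have W: "sum_list (map w ?xs) = w x + w y + w (x + x) + w p" by simp
    have "w x + w y + w (x + x) + w p \<le> (\<Sum>a\<in>A. w a)"
      using distinct_sum_w_le[OF xs] unfolding W .
    moreover from p1 have two: "2 * q \<le> w x + w y + w (x + x) + w p + 2" by (elim disjE) linarith+
    ultimately have q4: "q = 4" and S8: "(\<Sum>a\<in>A. w a) \<le> 8" using q bound by linarith+
    have six: "6 \<le> sum_list (map w ?xs)" using two q4 unfolding W by linarith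
    \<comment> \<open>A third generator would add 3 to a weight of at least 6, exceeding 8.\<close>
    have xyM: "set_mset M \<subseteq> {x, y}" if M: "mon M" "size M = 3" for M
    proof
      fix z assume z: "z \<in># M"
      show "z \<in> {x, y}"
      proof (rule ccontr)
        assume "z \<notin> {x, y}"
        then have "\<forall>a\<in>set ?xs. z \<notin># rep a" using rp xr xyG by (elim disjE) (simp_all add: rep_G)
        then have "sum_list (map w ?xs) + 3 \<le> (\<Sum>a\<in>A. w a)"
          by (rule extra_generator[OF M z xs(2,1)])
        then show False using six S8 by linarith
      qed
    qed
    \<comment> \<open>A cubic below \<open>c\<close> forces large weights on its divisors, and in
      each case the total exceeds 8. Since a proper divisor always lies below \<open>c\<close>,
      degrees above 3 are thereby excluded as well.\<close>
    have ge: "c \<le> sum_mset M" if M: "mon M" "size M = 3" for M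
    proof (rule ccontr)
      assume "\<not> c \<le> sum_mset M"
      then have less: "sum_mset M < c" by simp
      have wp: "0 < w p" "0 < w (x + x)" "w (x + x) < w x"
        using w_pos pA xA w_add_less[of x x] xyG by auto
      have size2: "\<forall>a\<in>set ?xs. size (rep a) \<le> 2"
        using rp xr xyG by (elim disjE) (simp_all add: rep_G)
      consider "M = {#x, x, x#}" | "M = {#x, x, y#}" | "M = {#x, y, y#}" | "M = {#y, y, y#}"
        using two_elements_cubic[OF xyM[OF M] M(2)] by blast
      then show False
      proof cases
        case 1
        have t: "mon {#x, x, x#}" "x + x + x < c" using M less 1 by (simp_all add: add.assoc)
        note cb = cubic_below_c[OF t]
        have "sum_list (map w ?xs) + w (x + x + x) \<le> 8"
          using extend_distinct[OF xs(1) size2 xs(2), of "x + x + x"] cb S8 by simp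
        then show False unfolding W using cb wp py by linarith
      next
        case 2
        have t: "mon {#x, x, y#}" "x + x + y < c" using M less 2 by (simp_all add: add.assoc)
        note cb = cubic_below_c[OF t]
        have t': "mon {#x, y, x#}" "x + y + x < c" using t by (simp_all add: add_mset_commute add.commute add.left_commute)
        have "sum_list (map w ?xs) + w (x + x + y) \<le> 8"
          using extend_distinct[OF xs(1) size2 xs(2), of "x + x + y"] cb S8 by simp
        then show False unfolding W using cb cubic_below_c(3)[OF t'] wp py by linarith
      next
        case 3
        have t: "mon {#x, y, y#}" "x + y + y < c" using M less 3 by (simp_all add: add.assoc)
        note cb = cubic_below_c[OF t]
        have px: "p = x + y" using p t(1) by blast
        have "sum_list (map w ?xs) + w (x + y + y) \<le> 8"
          using extend_distinct[OF xs(1) size2 xs(2), of "x + y + y"] cb S8 by simp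
        then show False unfolding W unfolding px using cb wp by linarith
      next
        case 4
        have t: "mon {#y, y, y#}" "y + y + y < c" using M less 4 by (simp_all add: add.assoc)
        note cb = cubic_below_c[OF t]
        have yy: "sum_list (map w ?xs) + w (y + y + y) \<le> 8"
          using extend_distinct[OF xs(1) size2 xs(2), of "y + y + y"] cb S8 by simp
        show False
        proof (cases "p = y + y")
          case True
          then show False using yy unfolding W unfolding True using cb wp by linarith
        next
          case False
          then have rp: "rep p = {#x, y#}" using p by blast
          have ry: "y + y \<in> A" "rep (y + y) = {#y, y#}" using cubic[OF t(1)] by auto
          have "sum_list (map w ((y + y) # ?xs)) + w (y + y + y) \<le> (\<Sum>a\<in>A. w a)"
          proof (rule extend_distinct)
            show "distinct (map rep ((y + y) # ?xs))"
              using xs(1) ry(2) xr rp xy xyG by (auto simp: rep_G doubleton_mset_eq_iff)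
          qed (use size2 xs(2) ry cb in auto)
          then have "w (y + y) + (w x + w y + w (x + x) + w p) + w (y + y + y) \<le> 8" using S8 by simp
          then show False using cb wp by linarith
        qed
      qed
    qed
    show ?thesis
    proof (rule core_two_generators[OF q4 S8 xy xyG _ base])
      fix z assume z: "z \<in> Z3"
      have zZ: "z \<in> Z" "3 \<le> size (rep z)" using z by (simp_all add: Z3_def)
      have "size (rep z) = 3"
      proof (rule ccontr)
        assume "size (rep z) \<noteq> 3"
        moreover obtain g where "g \<in># rep z" using zZ(2) by (cases "rep z") auto
        then obtain u v where uv: "mon {#g, u, v#}" "{#g, u, v#} \<subseteq># rep z"
          by (rule mon_cubic_sub[OF z])
        obtain K where K: "rep z = {#g, u, v#} + K" using uv(2) by (metis subset_mset.add_diff_inverse)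
        ultimately have "K \<noteq> {#}" by auto
        then have "sum_mset {#g, u, v#} \<in> A" using rep_part(1)[OF zZ(1) K] by simp
        then show False using ge[OF uv(1)] by (simp add: A_def)
      qed
      then show "rep z \<in> {{#x, x, x#}, {#x, x, y#}, {#x, y, y#}, {#y, y, y#}}"
        using two_elements_cubic[OF xyM[OF mon_rep[OF zZ(1)]]] by simp
    qed
  qed
qed

lemma core_if_bound:
  assumes "q + (\<Sum>a\<in>A. w a) \<le> 12" shows core
proof -
  have "2 \<le> q"
  proof (rule ccontr)
    assume "\<not> 2 \<le> q"
    then have "q * m \<le> 1 * m" by (intro mult_le_mono1) simp
    then show False using c_eq m_less by linarith
  qed
  then consider "q = 2" | "q = 3" | "4 \<le> q" by linarith
  then show ?thesis
  proof cases
    case 1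
    \<comment> \<open>A cubic has a quadratic divisor below \<open>c\<close>, yet that divisor is at
      least \<open>2 * m \<ge> c\<close>.\<close>
    have "Z3 = {}"
    proof (rule ccontr)
      assume "Z3 \<noteq> {}"
      then obtain z where z: "z \<in> Z3" by blast
      then obtain g where "g \<in># rep z" by (cases "rep z") (auto simp: Z3_def)
      then obtain u v where "mon {#g, u, v#}" by (rule mon_cubic_sub[OF z])
      note cu = cubic[OF this]
      have "g + u < c" "m \<le> g" "m \<le> u" using cu G_in_S m_le by (auto simp: A_def)
      then show False using c_eq 1 by simp
    qed
    then show ?thesis by (rule core_no_cubics)
  qed (use core_depth_3 core_depth_ge_4 assms in blast)+
qed


section \<open>Wilf numbers\<close>

lemma w_0: "w 0 = q"
  using rho_less by (simp add: w_def)

lemma apery_0: "apery 0"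
  using zero m_pos by (simp add: apery_def)

lemma multiple_m_in: "k * m \<in> S"
  by (induction k) (auto simp: zero add m_in)

text \<open>The elements \<open>a + k * m\<close> with \<open>k < w a\<close> lie below
  \<open>c\<close>, and residues separate the progressions. The \<open>q\<close> comes from the
  multiples of \<open>m\<close>, as \<open>w 0 = q\<close>.\<close>

lemma card_left_ge: "q + (\<Sum>a\<in>A. w a) \<le> card (S \<inter> {..<c})"
proof -
  let ?P = "Sigma (insert 0 A) (\<lambda>a. {..<w a})"
  let ?h = "\<lambda>(a, k). a + k * m"
  have ap: "apery a" if "a \<in> insert 0 A" for a using that apery_0 by (auto simp: A_def)
  have "inj_on ?h ?P"
  proof (rule inj_onI)
    fix u v assume uv: "u \<in> ?P" "v \<in> ?P" "?h u = ?h v"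
    obtain a k b l where ab: "u = (a, k)" "v = (b, l)" by fastforce
    have eq: "a + k * m = b + l * m" using uv(3) ab by simp
    then have "(a + k * m) mod m = (b + l * m) mod m" by simp
    then have "a mod m = b mod m" by simp
    then have "a = b" using apery_cong ap uv(1,2) ab by simp
    then show "u = v" using eq ab m_pos by simp
  qed
  moreover have "?h ` ?P \<subseteq> S \<inter> {..<c}"
  proof
    fix y assume "y \<in> ?h ` ?P"
    then obtain a k where "a \<in> insert 0 A" "k < w a" "y = a + k * m" by auto
    then show "y \<in> S \<inter> {..<c}" using ap[of a] multiple_m_in[of k] by (simp add: less_w_iff add apery_def)
  qed
  ultimately have "card ?P \<le> card (S \<inter> {..<c})" by (intro card_inj_on_le) auto
  moreover have "card ?P = (\<Sum>a\<in>insert 0 A. w a)" using finite_A by simp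
  moreover have "0 \<notin> A" by (simp add: A_def)
  ultimately show ?thesis using finite_A by (simp add: w_0)
qed

lemma apery_below:
  assumes "x \<in> S" obtains a where "apery a" "a \<le> x" "a mod m = x mod m" "a = x \<or> a + m \<le> x"
  using assms
proof (induction x arbitrary: thesis rule: less_induct)
  case (less x)
  show ?case
  proof (cases "apery x")
    case True then show ?thesis using less.prems by blast
  next
    case False
    then obtain s where s: "s \<in> S" "x = s + m" using less.prems(2) by (auto simp: apery_def)
    have "s < x" using s m_pos by simp
    then obtain a where "apery a" "a \<le> s" "a mod m = s mod m" using less.IH s(1) by blast
    then show ?thesis using less.prems(1)[of a] s(2) by simp
  qed
qed

text \<open>Elements of \<open>[c, c + m)\<close> have distinct residues. The Apery element in the
  class of such a decomposable \<open>x\<close> is \<open>x\<close> itself, hence in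
  \<open>Z\<close>, or lies below \<open>c\<close>, hence is \<open>0\<close> or in
  \<open>A\<close>; the part of \<open>A\<close> outside \<open>G\<close> is already in
  \<open>Z\<close>.\<close>

lemma card_dec_le: "card {x \<in> S. dec x \<and> c \<le> x \<and> x < c + m} \<le> 1 + card G + card Z"
proof -
  let ?X = "{x \<in> S. dec x \<and> c \<le> x \<and> x < c + m}"
  let ?Y = "insert 0 (A \<union> Z)"
  have fin: "finite ?Y" using finite_A finite_Z by simp
  have "card ?X \<le> card ((\<lambda>x. x mod m) ` ?Y)"
  proof (rule card_inj_on_le)
    show "inj_on (\<lambda>x. x mod m) ?X"
    proof (rule inj_onI)
      have le: "y \<le> x" if "x \<in> ?X" "y \<in> ?X" "x mod m = y mod m" for x y
      proof (rule ccontr)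
        assume "\<not> y \<le> x"
        then have "m dvd y - x" "0 < y - x" using mod_eq_dvd_iff_nat[of x y m] that(3) by simp_all
        then have "m \<le> y - x" by (rule dvd_imp_le)
        moreover have "c \<le> x" "y < c + m" using that by simp_all
        ultimately show False using \<open>0 < y - x\<close> by linarith
      qed
      fix x y assume "x \<in> ?X" "y \<in> ?X" "x mod m = y mod m"
      then show "x = y" using le[of x y] le[of y x] by simp
    qed
    show "(\<lambda>x. x mod m) ` ?X \<subseteq> (\<lambda>x. x mod m) ` ?Y"
    proof
      fix r assume "r \<in> (\<lambda>x. x mod m) ` ?X"
      then obtain x where x: "x \<in> S" "dec x" "c \<le> x" "x < c + m" "r = x mod m" by blast
      obtain a where a: "apery a" "a mod m = x mod m" "a = x \<or> a + m \<le> x"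
        using apery_below[OF x(1)] by blast
      have "a \<in> ?Y"
      proof (cases "a = x")
        case True then show ?thesis using a x by (simp add: Z_def)
      next
        case False
        then have "a < c" using a(3) x(4) by simp
        then show ?thesis using a(1) by (cases "a = 0") (simp_all add: A_def)
      qed
      then show "r \<in> (\<lambda>x. x mod m) ` ?Y" using a(2) x(5) by (intro image_eqI[of _ _ a]) auto
    qed
  qed (use fin in simp)
  also have "\<dots> \<le> card ?Y" by (rule card_image_le[OF fin])
  also have "?Y = insert 0 (G \<union> Z)" unfolding A_eq by auto
  also have "card \<dots> \<le> 1 + card (G \<union> Z)" using finite_G finite_Z by (simp add: card_insert_if)
  also have "card (G \<union> Z) \<le> card G + card Z" by (rule card_Un_le)
  finally show ?thesis by simp
qed

lemma primitives_left: "primitives S \<inter> {..<c} = insert m G"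
proof -
  have dec: "\<not> (\<exists>a\<in>nonzero_part S. \<exists>b\<in>nonzero_part S. x = a + b) \<longleftrightarrow> \<not> dec x" for x
    unfolding nonzero_part_def dec_def by auto
  have "\<not> dec m"
  proof
    assume "dec m"
    then obtain a b where "a \<in> S" "b \<in> S" "0 < a" "0 < b" "m = a + b" unfolding dec_def by blast
    then show False using m_le[of a] by simp
  qed
  then show ?thesis unfolding primitives_def dec unfolding nonzero_part_def G_def
    using m_in m_pos m_less by auto
qed

text \<open>The term \<open>q * (1 + card G)\<close> from \<open>card_dec_le\<close> is matched by
  the \<open>q\<close> multiples of \<open>m\<close> in the left part; what remains is
  \<open>core\<close>.\<close>

lemma Wilf0_nonneg:
  assumes "card (S \<inter> {..<c}) \<le> 12"
  shows "q * card {x \<in> S. dec x \<and> c \<le> x \<and> x < c + m}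
    \<le> card (primitives S \<inter> {..<c}) * card (S \<inter> {..<c}) + \<rho>"
proof -
  have core: core using core_if_bound card_left_ge assms by linarith
  have n: "card (primitives S \<inter> {..<c}) = card G + 1"
    unfolding primitives_left using finite_G by (simp add: G_def)
  have "q * card {x \<in> S. dec x \<and> c \<le> x \<and> x < c + m} \<le> q * (1 + card G + card Z)"
    by (rule mult_le_mono2[OF card_dec_le])
  also have "\<dots> = (card G + 1) * q + q * card Z" by (simp add: algebra_simps)
  also have "\<dots> \<le> (card G + 1) * q + ((card G + 1) * (\<Sum>a\<in>A. w a) + \<rho>)"
    using core unfolding core_def by simp
  also have "\<dots> = (card G + 1) * (q + (\<Sum>a\<in>A. w a)) + \<rho>" by (simp add: algebra_simps)
  also have "\<dots> \<le> (card G + 1) * card (S \<inter> {..<c}) + \<rho>"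
    using card_left_ge by (intro add_right_mono mult_le_mono2)
  finally show ?thesis unfolding n .
qed

end

section \<open>Transfer to numerical semigroups, and comparison of the two Wilf numbers\<close>

context
  fixes S :: "nat set"
  assumes S: "numerical_semigroup S"
begin

lemma semigroup_facts:
  shows "0 \<in> S" "\<And>x y. x \<in> S \<Longrightarrow> y \<in> S \<Longrightarrow> x + y \<in> S"
    "multiplicity S \<in> S" "0 < multiplicity S" "\<And>x. x \<in> S \<Longrightarrow> 0 < x \<Longrightarrow> multiplicity S \<le> x"
    "\<And>x. conductor S \<le> x \<Longrightarrow> x \<in> S"
proof -
  show "0 \<in> S" "\<And>x y. x \<in> S \<Longrightarrow> y \<in> S \<Longrightarrow> x + y \<in> S"
    using S by (auto simp: numerical_semigroup_def)
  obtain k where k: "\<And>x. x \<in> UNIV - S \<Longrightarrow> x \<le> k"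
    using S unfolding numerical_semigroup_def finite_nat_set_iff_bounded_le by blast
  then have k': "{Suc k..} \<subseteq> S" using not_less_eq_eq by blast
  then have "{conductor S..} \<subseteq> S" unfolding conductor_def by (rule LeastI)
  then show "\<And>x. conductor S \<le> x \<Longrightarrow> x \<in> S" by auto
  have "Suc k \<in> nonzero_part S" using k' by (auto simp: nonzero_part_def)
  then have "multiplicity S \<in> nonzero_part S" unfolding multiplicity_def by (rule LeastI)
  then show "multiplicity S \<in> S" "0 < multiplicity S" by (auto simp: nonzero_part_def)
  show "multiplicity S \<le> x" if "x \<in> S" "0 < x" for x
    unfolding multiplicity_def by (rule Least_le) (use that in \<open>simp add: nonzero_part_def\<close>)
qed

lemma depth_offset:
  obtains q \<rho> where "depth S = int q" "offset S = int \<rho>"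
    "conductor S + \<rho> = q * multiplicity S" "\<rho> < multiplicity S"
proof -
  let ?m = "multiplicity S" and ?c = "conductor S"
  have m: "0 < ?m" by (rule semigroup_facts)
  have "(- 1 :: real) < 0" "0 \<le> real ?c / real ?m" by simp_all
  then have "- 1 < real ?c / real ?m" by (rule less_le_trans)
  then have "0 \<le> depth S" unfolding depth_def by simp
  have "real ?c / real ?m \<le> depth S" "depth S < real ?c / real ?m + 1"
    unfolding depth_def by linarith+
  then have "real ?c \<le> real_of_int (depth S) * real ?m"
    "real_of_int (depth S) * real ?m < real ?c + real ?m"
    using m by (simp_all add: field_simps)
  then have "real_of_int (int ?c) \<le> real_of_int (depth S * int ?m)"
    "real_of_int (depth S * int ?m) < real_of_int (int ?c + int ?m)" by simp_all
  then have *: "int ?c \<le> depth S * int ?m" "depth S * int ?m < int ?c + int ?m"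
    unfolding of_int_le_iff of_int_less_iff .
  show thesis
  proof (rule that[of "nat (depth S)" "nat (offset S)"])
    show "depth S = int (nat (depth S))" using \<open>0 \<le> depth S\<close> by simp
    show "offset S = int (nat (offset S))" using * by (simp add: offset_def)
    have "int (?c + nat (offset S)) = int (nat (depth S) * ?m)"
      using * \<open>0 \<le> depth S\<close> by (simp add: offset_def)
    then show "?c + nat (offset S) = nat (depth S) * ?m" by (simp only: of_nat_eq_iff)
    show "nat (offset S) < ?m" using * m by (simp add: offset_def)
  qed
qed

lemma decomposables_slice_depth:
  "decomposables_slice S (depth S)
    = {x \<in> decomposables S. conductor S \<le> x \<and> x < conductor S + multiplicity S}"
proof -
  have "int x \<in> slice S (depth S) \<longleftrightarrow> conductor S \<le> x \<and> x < conductor S + multiplicity S" for x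
    unfolding slice_def offset_def by (auto simp: algebra_simps)
  then show ?thesis by (simp add: decomposables_slice_def)
qed

lemma decomposables_ge:
  assumes "x \<in> decomposables S" shows "2 * multiplicity S \<le> x"
proof -
  obtain a b where "a \<in> S" "0 < a" "b \<in> S" "0 < b" "x = a + b"
    using assms unfolding decomposables_eq_sums[OF S] nonzero_part_def by blast
  then show ?thesis using semigroup_facts(5)[of a] semigroup_facts(5)[of b] by linarith
qed

text \<open>A primitive at or above \<open>c + m\<close> would split off \<open>m\<close>, so all
  lie below it. The \<open>m\<close> elements of \<open>[c, c + m)\<close> are in \<open>S\<close>,
  nonzero as \<open>c > 0\<close>, and each is primitive or decomposable.\<close>

lemma embedding_dimension_ge:
  assumes "0 < conductor S"
  shows "card (primitives S \<inter> left_part S) + multiplicity S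
    \<le> embedding_dimension S + card (decomposables_slice S (depth S))"
proof -
  let ?m = "multiplicity S" and ?c = "conductor S"
  let ?R = "primitives S \<inter> {?c..<?c + ?m}"
  have sub: "primitives S \<subseteq> {..<?c + ?m}"
  proof
    fix x assume x: "x \<in> primitives S"
    show "x \<in> {..<?c + ?m}"
    proof (rule ccontr)
      assume "x \<notin> {..<?c + ?m}"
      then have le: "?c + ?m \<le> x" by simp
      then have "x - ?m \<in> nonzero_part S" "?m \<in> nonzero_part S" "x = (x - ?m) + ?m"
        using semigroup_facts assms by (auto simp: nonzero_part_def)
      then show False using x unfolding primitives_def by blast
    qed
  qed
  then have fin: "finite (primitives S)" by (rule finite_subset) simp
  have "{?c..<?c + ?m} = ?R \<union> decomposables_slice S (depth S)"
    unfolding decomposables_slice_depth decomposables_def using semigroup_facts(6) assms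
    by (auto simp: nonzero_part_def)
  then have "card {?c..<?c + ?m} \<le> card ?R + card (decomposables_slice S (depth S))"
    using card_Un_le by metis
  moreover have "card (primitives S \<inter> left_part S) + card ?R \<le> card (primitives S)"
  proof -
    have "card (primitives S \<inter> left_part S) + card ?R = card ((primitives S \<inter> left_part S) \<union> ?R)"
      using fin by (intro card_Un_disjoint[symmetric]) (auto simp: left_part_def)
    also have "\<dots> \<le> card (primitives S)" using fin by (intro card_mono) auto
    finally show ?thesis .
  qed
  ultimately show ?thesis by (simp add: embedding_dimension_def)
qed

text \<open>The \<open>q\<close> multiples \<open>k * m\<close> with \<open>k < q\<close> lie below
  the conductor because \<open>\<rho> < m\<close>.\<close>

lemma depth_le_card_left: "depth S \<le> int (card (left_part S))"
proof -
  let ?m = "multiplicity S" and ?c = "conductor S"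
  obtain q \<rho> where q: "depth S = int q" "?c + \<rho> = q * ?m" "\<rho> < ?m" using depth_offset by metis
  have m: "0 < ?m" by (rule semigroup_facts)
  have mult: "k * ?m \<in> S" for k by (induction k) (auto simp: semigroup_facts)
  have "card {..<q} \<le> card (left_part S)"
  proof (rule card_inj_on_le)
    show "inj_on (\<lambda>k. k * ?m) {..<q}" using m by (auto simp: inj_on_def)
    have "k * ?m < ?c" if "k < q" for k
    proof -
      have "Suc k * ?m \<le> q * ?m" using that by (intro mult_le_mono1) simp
      then show ?thesis using q(2,3) by simp
    qed
    then show "(\<lambda>k. k * ?m) ` {..<q} \<subseteq> left_part S" using mult by (auto simp: left_part_def)
  qed (simp add: left_part_def)
  then show ?thesis using q(1) by simp
qed

text \<open>In the notation of the proof the difference is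
  \<open>(?e - ?p) * ?l - depth S * (?m - ?d)\<close>, where
  \<open>?e - ?p \<ge> ?m - ?d \<ge> 0\<close> and \<open>?l \<ge> depth S\<close>. Conductor 0
  means \<open>S = UNIV\<close>, where both numbers vanish.\<close>

lemma Wilf_number0_le_Wilf_number: "Wilf_number0 S \<le> Wilf_number S"
proof (cases "conductor S = 0")
  case True
  then show ?thesis
    by (simp add: Wilf_number0_def Wilf_number_def left_part_def depth_def offset_def)
next
  case False
  let ?m = "int (multiplicity S)" and ?l = "int (card (left_part S))"
  let ?d = "int (card (decomposables_slice S (depth S)))" and ?e = "int (embedding_dimension S)"
  let ?p = "int (card (primitives S \<inter> left_part S))"
  have "card (decomposables_slice S (depth S)) \<le> card {conductor S..<conductor S + multiplicity S}"
    unfolding decomposables_slice_depth by (intro card_mono) auto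
  then have d: "?d \<le> ?m" by simp
  have "?p + (?m - ?d) \<le> ?e" using embedding_dimension_ge False by simp
  then have "(?p + (?m - ?d)) * ?l \<le> ?e * ?l" by (intro mult_right_mono) auto
  moreover have "(?m - ?d) * depth S \<le> (?m - ?d) * ?l"
    using d depth_le_card_left by (intro mult_left_mono) auto
  ultimately show ?thesis
    unfolding Wilf_number0_def Wilf_number_def offset_def by (simp add: algebra_simps)
qed

lemma Wilf_number0_nonneg:
  assumes "card (left_part S) \<le> 12"
  shows "0 \<le> Wilf_number0 S"
proof -
  let ?m = "multiplicity S" and ?c = "conductor S"
  obtain q \<rho> where q: "depth S = int q" "offset S = int \<rho>" "?c + \<rho> = q * ?m" "\<rho> < ?m"
    by (rule depth_offset)
  have left: "left_part S = S \<inter> {..<?c}" by (simp add: left_part_def)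
  show ?thesis
  proof (cases "?m < ?c")
    case True
    interpret left_semigroup S ?m ?c q \<rho>
      by unfold_locales (use semigroup_facts q True in auto)
    have slice: "decomposables_slice S (depth S) = {x \<in> S. dec x \<and> ?c \<le> x \<and> x < ?c + ?m}"
      unfolding decomposables_slice_depth decomposables_eq_sums[OF S] nonzero_part_def dec_def
      by (auto simp: semigroup_facts)
    have prim: "primitives S \<inter> left_part S = primitives S \<inter> {..<?c}"
      by (auto simp: left_part_def primitives_def nonzero_part_def)
    have "int (q * card {x \<in> S. dec x \<and> ?c \<le> x \<and> x < ?c + ?m})
        \<le> int (card (primitives S \<inter> {..<?c}) * card (S \<inter> {..<?c}) + \<rho>)"
      using Wilf0_nonneg assms unfolding left by (simp only: of_nat_le_iff)
    then show ?thesis unfolding Wilf_number0_def prim slice unfolding left q(1,2) by simp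
  next
    \<comment> \<open>Here \<open>c \<le> m\<close>, so a decomposable, being at least
      \<open>2 * m\<close>, is at least \<open>c + m\<close>; the negative term vanishes.\<close>
    case False
    have "decomposables_slice S (depth S) = {}"
      unfolding decomposables_slice_depth using decomposables_ge False by fastforce
    then show ?thesis unfolding Wilf_number0_def q by simp
  qed
qed

end

theorem theorem4p1:
  fixes S :: "nat set"
  assumes "numerical_semigroup S"
    and "card (left_part S) \<le> 12"
  shows "Wilf_number0 S \<ge> 0 \<and> Wilf_number S \<ge> 0"
  using Wilf_number0_nonneg[OF assms] Wilf_number0_le_Wilf_number[OF assms(1)] by linarith
end
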